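(* Let $\mathrm{Ha}>0$ and $\mathrm{Pm}>0$, let $\mathrm{Re}>0$, and put $\mathrm{Rm}=\mathrm{Pm}\,\mathrm{Re}$ and $A=\mathrm{Ha}^2\mathrm{Pm}$. Consider either of the following basic (laminar) solutions $\mathbf v=(U(z),0,0)$, $\hat{\mathbf B}=(\bar B(z),0,\mathrm{Rm}^{-1})$ of the stationary non-dimensional magnetohydrodynamics equations in the layer $\mathbb R^2\times[-1,1]$: (i) the magnetic Couette flow $U(z)=\dfrac{\sinh(\mathrm{Ha}\,z)}{\sinh(\mathrm{Ha})}$, $\bar B(z)=\dfrac{\cosh(\mathrm{Ha})-\cosh(\mathrm{Ha}\,z)}{\mathrm{Ha}\sinh(\mathrm{Ha})}$; (ii) the Hartmann flow $U(z)=\dfrac{\cosh(\mathrm{Ha})-\cosh(\mathrm{Ha}\,z)}{\cosh(\mathrm{Ha})-1}$, $\bar B(z)=\dfrac{\sinh(\mathrm{Ha}\,z)-z\sinh(\mathrm{Ha})}{\mathrm{Ha}(\cosh(\mathrm{Ha})-1)}$. Let $\mathrm{Re}_E$ be the energy critical Reynolds number defined in the context. If $\mathrm{Re}<\mathrm{Re}_E$, then the basic magnetic Couette and Hartmann motions are monotonically asymptotically stable in the energy norm $E$: every perturbation $(\mathbf u,\mathbf h,\bar\pi)$ as described in the context satisfies $$E(t)\le E(0)\,e^{\frac{\pi^2}{2}c_0(\mathrm{Re}-\mathrm{Re}_E)t}\qquad\text{for all }t\ge 0,$$ with a positive constant $c_0$ depending on $\mathrm{Ha}$ and $\mathrm{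Pm}$.
   Context: Perturbations: $\mathbf u=(u,v,w)$, $\mathbf h=(h,k,\ell)$, $\bar\pi$ are $C^2$ functions of $(x,y,z,t)$, $z\in[-1,1]$, periodic in $x$ and $y$ with periodicity cell $\Omega=[0,2\pi/a]\times[0,2\pi/b]\times[-1,1]$, satisfying rigid and non-conducting boundary conditions $\mathbf u=\mathbf h=0$ on $z=\pm1$, and solving $$\mathbf u_t+U\mathbf u_x+wU'\mathbf i+\mathbf u\cdot\nabla\mathbf u=A\Big[\bar B\mathbf h_x+\frac{\mathbf h_z}{\mathrm{Rm}}+\ell\bar B'\mathbf i+\mathbf h\cdot\nabla\mathbf h\Big]-\nabla\bar\pi+\frac{\Delta\mathbf u}{\mathrm{Re}},$$ $$\mathbf h_t+w\bar B'\mathbf i+U\mathbf h_x+\mathbf u\cdot\nabla\mathbf h-\bar B\mathbf u_x-\frac{\mathbf u_z}{\mathrm{Rm}}-\ell U'\mathbf i-\mathbf h\cdot\nabla\mathbf u=\frac{\Delta\mathbf h}{\mathrm{Rm}},\qquad\nabla\cdot\mathbf u=\nabla\cdot\mathbf h=0,$$ where $\mathbf i$ is the unit vector in the $x$ direction and $'$ denotes $d/dz$. $(\cdot,\cdot)$ and $\|\cdot\|$ are the $L^2(\Omega)$ inner product and norm. The energy is $E(t)=\tfrac12(\|\mathbf u\|^2+A\|\mathbf h\|^2)$. Let $\mathcal S$ be the set of pairs $(\mathbf u,\mathbf h)$ of vector fields on $\Omega$ with components in $W^{1,2}(\Omega)$, periodic in $x,y$, vanishing at $z=\pm1$, divergence-free,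 with $\|\nabla\mathbf u\|+\|\nabla\mathbf h\|>0$. Define $$I=-(U'w,u)+A\big[(\ell\bar B',u)-(w\bar B',h)+(\ell U',h)\big],\qquad \mathcal D_1=\|\nabla u\|^2+\|\nabla w\|^2+\mathrm{Ha}^2\big[\|\nabla h\|^2+\|\nabla\ell\|^2\big].$$ The critical Reynolds number $\mathrm{Re}_E$ is defined by $\mathrm{Re}_E^{-1}=m=\max_{\mathcal S} I/\mathcal D_1$ (the maximum exists). *)

theory Defs
  imports "HOL-Analysis.Analysis"
begin

definition U_couette :: "real \<Rightarrow> real \<Rightarrow> real" where
  "U_couette Ha z = sinh (Ha * z) / sinh Ha"
definition B_couette :: "real \<Rightarrow> real \<Rightarrow> real" where
  "B_couette Ha z = (cosh Ha - cosh (Ha * z)) / (Ha * sinh Ha)"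
definition U_hartmann :: "real \<Rightarrow> real \<Rightarrow> real" where
  "U_hartmann Ha z = (cosh Ha - cosh (Ha * z)) / (cosh Ha - 1)"
definition B_hartmann :: "real \<Rightarrow> real \<Rightarrow> real" where
  "B_hartmann Ha z = (sinh (Ha * z) - z * sinh Ha) / (Ha * (cosh Ha - 1))"

text \<open>A space-time point is (p, t) with p = (x,y,z); x = p$1, y = p$2, z = p$3.
  Perturbations are considered on the closed slab z in [-1,1], t >= 0.\<close>

type_synonym pt = "(real^3) \<times> real"

definition Dom :: "pt set" where
  "Dom = {(p, t). -1 \<le> p$3 \<and> p$3 \<le> 1 \<and> 0 \<le> t}"

text \<open>Directional (partial) derivative, taken within Dom (one-sided at the boundary).\<close>
definition pd :: "pt \<Rightarrow> (pt \<Rightarrow> 'b::real_normed_vector) \<Rightarrow> pt \<Rightarrow> 'b" where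
  "pd v F q = frechet_derivative F (at q within Dom) v"

definition C1_Dom :: "(pt \<Rightarrow> 'b::real_normed_vector) \<Rightarrow> bool" where
  "C1_Dom F \<longleftrightarrow> (\<forall>q\<in>Dom. F differentiable (at q within Dom)) \<and> (\<forall>v. continuous_on Dom (pd v F))"

definition C2_Dom :: "(pt \<Rightarrow> 'b::real_normed_vector) \<Rightarrow> bool" where
  "C2_Dom F \<longleftrightarrow> C1_Dom F \<and> (\<forall>v. C1_Dom (pd v F))"

definition sdir :: "3 \<Rightarrow> pt" where "sdir i = (axis i 1, 0)"
definition tdir :: pt where "tdir = (0, 1)"

definition adv :: "(pt \<Rightarrow> real^3) \<Rightarrow> (pt \<Rightarrow> real^3) \<Rightarrow> pt \<Rightarrow> real^3" where
  "adv F G q = (\<Sum>i\<in>UNIV. (F q $ i) *\<^sub>R pd (sdir i) G q)"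
definition lap :: "(pt \<Rightarrow> real^3) \<Rightarrow> pt \<Rightarrow> real^3" where
  "lap F q = (\<Sum>i\<in>UNIV. pd (sdir i) (pd (sdir i) F) q)"
definition sgrad :: "(pt \<Rightarrow> real) \<Rightarrow> pt \<Rightarrow> real^3" where
  "sgrad P q = (\<chi> i. pd (sdir i) P q)"
definition dvg :: "(pt \<Rightarrow> real^3) \<Rightarrow> pt \<Rightarrow> real" where
  "dvg F q = (\<Sum>i\<in>UNIV. pd (sdir i) (\<lambda>r. F r $ i) q)"

definition cell :: "real \<Rightarrow> real \<Rightarrow> (real^3) set" where
  "cell a b = {p. 0 \<le> p$1 \<and> p$1 \<le> 2*pi/a \<and> 0 \<le> p$2 \<and> p$2 \<le> 2*pi/b \<and> -1 \<le> p$3 \<and> p$3 \<le> 1}"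

definition ip :: "real \<Rightarrow> real \<Rightarrow> (real^3 \<Rightarrow> real) \<Rightarrow> (real^3 \<Rightarrow> real) \<Rightarrow> real" where
  "ip a b f g = (LINT p:cell a b|lborel. f p * g p)"

definition energy :: "real \<Rightarrow> real \<Rightarrow> real \<Rightarrow> (pt \<Rightarrow> real^3) \<Rightarrow> (pt \<Rightarrow> real^3) \<Rightarrow> real \<Rightarrow> real" where
  "energy a b A u h t = (1/2) * ((LINT p:cell a b|lborel. (norm (u (p, t)))\<^sup>2)
                                 + A * (LINT p:cell a b|lborel. (norm (h (p, t)))\<^sup>2))"

definition perturbation ::
  "real \<Rightarrow> real \<Rightarrow> real \<Rightarrow> real \<Rightarrow> real \<Rightarrow> (real \<Rightarrow> real) \<Rightarrow> (real \<Rightarrow> real)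
   \<Rightarrow> (pt \<Rightarrow> real^3) \<Rightarrow> (pt \<Rightarrow> real^3) \<Rightarrow> (pt \<Rightarrow> real) \<Rightarrow> bool" where
  "perturbation a b Ha Pm Rey U Bb u h P \<longleftrightarrow>
    (let Rm = Pm * Rey; A = Ha\<^sup>2 * Pm in
     C2_Dom u \<and> C2_Dom h \<and> C2_Dom P \<and>
     (\<forall>p t. (p, t) \<in> Dom \<longrightarrow>
        u (p + axis 1 (2*pi/a), t) = u (p, t) \<and> u (p + axis 2 (2*pi/b), t) = u (p, t) \<and>
        h (p + axis 1 (2*pi/a), t) = h (p, t) \<and> h (p + axis 2 (2*pi/b), t) = h (p, t) \<and>
        P (p + axis 1 (2*pi/a), t) = P (p, t) \<and> P (p + axis 2 (2*pi/b), t) = P (p, t)) \<and>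
     (\<forall>p t. 0 \<le> t \<and> \<bar>p$3\<bar> = 1 \<longrightarrow> u (p, t) = 0 \<and> h (p, t) = 0) \<and>
     (\<forall>q\<in>Dom. let z = fst q $ 3; w = u q $ 3; l = h q $ 3 in
        pd tdir u q + U z *\<^sub>R pd (sdir 1) u q + (w * deriv U z) *\<^sub>R axis 1 1 + adv u u q
          = A *\<^sub>R (Bb z *\<^sub>R pd (sdir 1) h q + (1 / Rm) *\<^sub>R pd (sdir 3) h q
                     + (l * deriv Bb z) *\<^sub>R axis 1 1 + adv h h q)
            - sgrad P q + (1 / Rey) *\<^sub>R lap u q
      \<and> pd tdir h q + (w * deriv Bb z) *\<^sub>R axis 1 1 + U z *\<^sub>R pd (sdir 1) h q + adv u h q
          - Bb z *\<^sub>R pd (sdir 1) u q - (1 / Rm) *\<^sub>R pd (sdir 3) u q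
          - (l * deriv U z) *\<^sub>R axis 1 1 - adv h u q
          = (1 / Rm) *\<^sub>R lap h q
      \<and> dvg u q = 0 \<and> dvg h q = 0))"

primrec Ck :: "nat \<Rightarrow> (real^3 \<Rightarrow> real) \<Rightarrow> bool" where
  "Ck 0 f = continuous_on UNIV f"
| "Ck (Suc n) f = ((\<forall>p. f differentiable (at p)) \<and> (\<forall>v. Ck n (\<lambda>p. frechet_derivative f (at p) v)))"

definition test_fun :: "(real^3 \<Rightarrow> real) \<Rightarrow> bool" where
  "test_fun \<phi> \<longleftrightarrow> (\<forall>n. Ck n \<phi>) \<and> compact (closure {p. \<phi> p \<noteq> 0})"

definition weak_grad :: "(real^3 \<Rightarrow> real) \<Rightarrow> (real^3 \<Rightarrow> real^3) \<Rightarrow> bool" where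
  "weak_grad f g \<longleftrightarrow> (\<forall>\<phi> i. test_fun \<phi> \<longrightarrow>
     (\<integral>p. f p * frechet_derivative \<phi> (at p) (axis i 1) \<partial>lborel) = - (\<integral>p. g p $ i * \<phi> p \<partial>lborel))"

definition L2loc :: "(real^3 \<Rightarrow> real) \<Rightarrow> bool" where
  "L2loc f \<longleftrightarrow> f \<in> borel_measurable lborel \<and>
     (\<forall>K. compact K \<longrightarrow> set_integrable lborel K (\<lambda>p. (f p)\<^sup>2))"

text \<open>A scalar function in W^{1,2}(Omega), periodic in x and y, vanishing at z = +-1,
  represented by its periodic extension in x,y and its zero extension for |z| > 1,
  together with its weak gradient g.\<close>
definition H1_adm :: "real \<Rightarrow> real \<Rightarrow> (real^3 \<Rightarrow> real) \<Rightarrow> (real^3 \<Rightarrow> real^3) \<Rightarrow> bool" where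
  "H1_adm a b f g \<longleftrightarrow> L2loc f \<and> (\<forall>i. L2loc (\<lambda>p. g p $ i)) \<and> weak_grad f g \<and>
     (AE p in lborel. f (p + axis 1 (2*pi/a)) = f p) \<and>
     (AE p in lborel. f (p + axis 2 (2*pi/b)) = f p) \<and>
     (\<forall>p. 1 < \<bar>p$3\<bar> \<longrightarrow> f p = 0)"

definition gn2 :: "real \<Rightarrow> real \<Rightarrow> (real^3 \<Rightarrow> real^3) \<Rightarrow> real" where
  "gn2 a b G = (LINT p:cell a b|lborel. (norm (G p))\<^sup>2)"

text \<open>Vector fields u with weak Jacobian Du (Du p $ j $ i = d_i u_j).\<close>
definition adm :: "real \<Rightarrow> real \<Rightarrow> (real^3 \<Rightarrow> real^3) \<Rightarrow> (real^3 \<Rightarrow> real^3^3)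
                    \<Rightarrow> (real^3 \<Rightarrow> real^3) \<Rightarrow> (real^3 \<Rightarrow> real^3^3) \<Rightarrow> bool" where
  "adm a b u Du h Dh \<longleftrightarrow>
     (\<forall>j. H1_adm a b (\<lambda>p. u p $ j) (\<lambda>p. Du p $ j)) \<and>
     (\<forall>j. H1_adm a b (\<lambda>p. h p $ j) (\<lambda>p. Dh p $ j)) \<and>
     (AE p in lborel. (\<Sum>i\<in>UNIV. Du p $ i $ i) = 0) \<and>
     (AE p in lborel. (\<Sum>i\<in>UNIV. Dh p $ i $ i) = 0) \<and>
     sqrt (\<Sum>j\<in>UNIV. gn2 a b (\<lambda>p. Du p $ j)) + sqrt (\<Sum>j\<in>UNIV. gn2 a b (\<lambda>p. Dh p $ j)) > 0"

definition Iform :: "real \<Rightarrow> real \<Rightarrow> real \<Rightarrow> (real \<Rightarrow> real) \<Rightarrow> (real \<Rightarrow> real)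
                     \<Rightarrow> (real^3 \<Rightarrow> real^3) \<Rightarrow> (real^3 \<Rightarrow> real^3) \<Rightarrow> real" where
  "Iform a b A U Bb u h =
     - ip a b (\<lambda>p. deriv U (p$3) * u p $ 3) (\<lambda>p. u p $ 1)
     + A * (ip a b (\<lambda>p. h p $ 3 * deriv Bb (p$3)) (\<lambda>p. u p $ 1)
            - ip a b (\<lambda>p. u p $ 3 * deriv Bb (p$3)) (\<lambda>p. h p $ 1)
            + ip a b (\<lambda>p. h p $ 3 * deriv U (p$3)) (\<lambda>p. h p $ 1))"

definition D1form :: "real \<Rightarrow> real \<Rightarrow> real \<Rightarrow> (real^3 \<Rightarrow> real^3^3) \<Rightarrow> (real^3 \<Rightarrow> real^3^3) \<Rightarrow> real" where
  "D1form a b Ha Du Dh =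
     gn2 a b (\<lambda>p. Du p $ 1) + gn2 a b (\<lambda>p. Du p $ 3)
     + Ha\<^sup>2 * (gn2 a b (\<lambda>p. Dh p $ 1) + gn2 a b (\<lambda>p. Dh p $ 3))"

definition ReE :: "real \<Rightarrow> real \<Rightarrow> real \<Rightarrow> real \<Rightarrow> (real \<Rightarrow> real) \<Rightarrow> (real \<Rightarrow> real) \<Rightarrow> real" where
  "ReE a b Ha Pm U Bb = 1 / Sup {Iform a b (Ha\<^sup>2 * Pm) U Bb u h / D1form a b Ha Du Dh
                                 | u Du h Dh. adm a b u Du h Dh}"

end

theory Submission
  imports Defs
begin

text \<open>Testing the equations with u and A h, all transport, magnetic coupling and pressure terms integrate
  to zero over the cell, so E' = I - D/Re with D the full weighted gradient norm. By definition of Re_E,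
  I is at most D1/Re_E, hence at most D/Re_E, and 1/Re - 1/Re_E is at least (Re_E - Re)/Re_E^2 for Re < Re_E.
  A Poincare inequality bounds D below by a multiple of E, and Gronwall's lemma gives the decay.
  Since c0 is only required to be positive, the sharp Poincare constant is not needed.

  The supremum defining Re_E is meaningful only once I/D1 is known to be bounded above on all of W^{1,2};
  therefore the Poincare inequality is proved for weak gradients, by representing f as an
  integral of its weak vertical derivative.\<close>

section \<open>Smooth compactly supported test functions\<close>

text \<open>Two obstacles shape the proof. Perturbations live on a closed slab, with derivatives
  taken within it, whereas the competitors in the supremum live on all of space with distributional
  gradients. The bridge is extension by zero: since the fields vanish on the walls, no boundary term
  arises, and the Jacobian cut off at the walls is the weak gradient of the cut-off field.
  Conversely, a weak gradient has no values on single lines, so the fundamental theorem of calculus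
  in z is obtained by duality: it is tested against bumps whose vertical averages are again test
  functions. Integrals along lines and over space meet in the shear (p, s) -> (p + s e, s), which
  preserves Lebesgue measure on the product. The quotient is bounded because I involves only the
  first and third components of u and h, and these are the components whose gradients enter D1. The
  bound is proved as |I| \<le> C D1, which also settles pairs with D1 = 0, where the quotient takes
  the default value 0.\<close>

definition flat :: "nat \<Rightarrow> real \<Rightarrow> real" where
  "flat k x = (if 0 < x then exp (- (1 / x)) / x ^ k else 0)"

text \<open>From the right, y = 1/x turns the limit into that of \<open>y ^ k / exp y\<close> at
  infinity; from the left the function is constantly 0.\<close>

lemma flat_tendsto_zero: "(flat k \<longlongrightarrow> 0) (at 0)"
proof -
  have "((\<lambda>y::real. y ^ k / exp y) \<longlongrightarrow> 0) at_top"
    by (rule tendsto_power_div_exp_0)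
  then have "((\<lambda>x::real. inverse x ^ k / exp (inverse x)) \<longlongrightarrow> 0) (at_right 0)"
    by (rule filterlim_compose[OF _ filterlim_inverse_at_top_right])
  then have "(flat k \<longlongrightarrow> 0) (at_right 0)"
    by (rule tendsto_cong[THEN iffD1, rotated])
      (auto simp: eventually_at_right_field flat_def exp_minus field_simps intro!: exI[of _ 1])
  moreover have "(flat k \<longlongrightarrow> 0) (at_left 0)"
    by (rule tendsto_eventually)
      (auto simp: eventually_at_left_field flat_def intro!: exI[of _ "-1"])
  ultimately show ?thesis
    by (simp add: filterlim_at_split)
qed

text \<open>Differentiation produces further negative powers of x. Carrying the exponent as a
  parameter closes the family under differentiation up to linear combinations, also at 0.\<close>

lemma DERIV_flat:
  "(flat k has_real_derivative (flat (k + 2) x - of_nat k * flat (k + 1) x)) (at x)"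
proof -
  consider "x < 0" | "x = 0" | "0 < x" by linarith
  then show ?thesis
  proof cases
    case 1
    have "((\<lambda>_. 0) has_real_derivative 0) (at x)" by simp
    then have "(flat k has_real_derivative 0) (at x)"
      by (rule has_field_derivative_transform_within_open[where S="{..<0}"])
        (use 1 in \<open>auto simp: flat_def\<close>)
    then show ?thesis using 1 by (simp add: flat_def)
  next
    case 2
    \<comment> \<open>The difference quotient of \<open>flat k\<close> at 0 is
      \<open>flat (k + 1)\<close>, whose limit is already known.\<close>
    have "((\<lambda>y. (flat k y - flat k 0) / (y - 0)) \<longlongrightarrow> 0) (at 0)"
      by (rule tendsto_cong[THEN iffD1, OF _ flat_tendsto_zero[of "k + 1"]])
        (auto simp: flat_def eventually_at_filter)
    then have "(flat k has_real_derivative 0) (at 0)"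
      by (simp add: has_field_derivative_iff)
    then show ?thesis using 2 by (simp add: flat_def)
  next
    case 3
    \<comment> \<open>Writing \<open>x ^ k / x\<close> for the lower power avoids the truncated
      subtraction \<open>k - 1\<close> at k = 0.\<close>
    have "((\<lambda>x. x ^ k) has_real_derivative of_nat k * x ^ k / x) (at x)"
      using DERIV_pow[of k x] 3 by (cases k) auto
    moreover have "((\<lambda>x. exp (- (1 / x))) has_real_derivative exp (- (1 / x)) / x\<^sup>2) (at x)"
      using 3 by (auto intro!: derivative_eq_intros simp: power2_eq_square)
    ultimately have "((\<lambda>x. exp (- (1 / x)) / x ^ k) has_real_derivative
        (exp (- (1 / x)) / x\<^sup>2 * x ^ k - exp (- (1 / x)) * (of_nat k * x ^ k / x)) / (x ^ k * x ^ k))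
        (at x)"
      using 3 by (intro DERIV_divide) auto
    also have "(exp (- (1 / x)) / x\<^sup>2 * x ^ k - exp (- (1 / x)) * (of_nat k * x ^ k / x)) / (x ^ k * x ^ k)
        = flat (k + 2) x - of_nat k * flat (k + 1) x"
      using 3 by (simp add: flat_def field_simps power2_eq_square)
    finally have "((\<lambda>x. exp (- (1 / x)) / x ^ k) has_real_derivative
        (flat (k + 2) x - of_nat k * flat (k + 1) x)) (at x)" .
    then show ?thesis
      by (rule has_field_derivative_transform_within_open[where S="{0<..}"])
        (use 3 in \<open>auto simp: flat_def\<close>)
  qed
qed

lemma continuous_on_flat [continuous_intros]:
  "continuous_on S f \<Longrightarrow> continuous_on S (\<lambda>x. flat k (f x))"
  by (rule continuous_on_compose2[of UNIV "flat k" S f])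
    (auto intro!: DERIV_continuous_on DERIV_flat)

lemma flat_0_bounds: "0 \<le> flat 0 x" "flat 0 x \<le> 1"
  by (auto simp: flat_def)

lemma flat_tendsto_one: "0 < x \<Longrightarrow> (\<lambda>n. flat 0 (of_nat (Suc n) * x)) \<longlonglongrightarrow> 1"
proof -
  assume x: "0 < x"
  have "(\<lambda>n. exp (- (inverse (of_nat (Suc n)) * (1 / x)))) \<longlonglongrightarrow> exp (- (0 * (1 / x)))"
    by (intro tendsto_intros LIMSEQ_inverse_real_of_nat)
  then show ?thesis
    using x by (simp add: flat_def inverse_eq_divide mult.commute)
qed

text \<open>Every directional derivative of a member is again a member, which gives all \<^term>\<open>Ck n\<close> at once.\<close>

inductive_set smooth_class :: "(real^3 \<Rightarrow> real) set" where
  const: "(\<lambda>p. c) \<in> smooth_class"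
| flat: "(\<lambda>p. flat k (c * p$i + d)) \<in> smooth_class"
| add: "f \<in> smooth_class \<Longrightarrow> g \<in> smooth_class \<Longrightarrow> (\<lambda>p. f p + g p) \<in> smooth_class"
| mult: "f \<in> smooth_class \<Longrightarrow> g \<in> smooth_class \<Longrightarrow> (\<lambda>p. f p * g p) \<in> smooth_class"
| primitive: "(\<And>s. (Q has_real_derivative q s) (at s)) \<Longrightarrow> (\<lambda>p. q (p$i)) \<in> smooth_class
    \<Longrightarrow> (\<lambda>p. Q (p$i)) \<in> smooth_class"

lemma has_derivative_component_comp:
  fixes p :: "real^3"
  assumes "(Q has_real_derivative q) (at (p$i))"
  shows "((\<lambda>p. Q (p$i)) has_derivative (\<lambda>v. q * v$i)) (at p)"
proof -
  have "((\<lambda>p::real^3. p$i) has_derivative (\<lambda>v. v$i)) (at p)"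
    by (rule bounded_linear.has_derivative[OF bounded_linear_vec_nth has_derivative_ident])
  from has_derivative_compose[OF this assms[unfolded has_field_derivative_def]]
  show ?thesis by (simp add: mult.commute)
qed

text \<open>Differentiability and membership of the derivative go through one induction: the
  derivative of a product stays in the class because the factors and their derivatives both
  do.\<close>

lemma smooth_class_has_derivative:
  assumes "f \<in> smooth_class"
  shows "\<exists>D. (\<forall>p. (f has_derivative D p) (at p)) \<and> (\<forall>v. (\<lambda>p. D p v) \<in> smooth_class)"
  using assms
proof induction
  case (const c)
  show ?case
    by (rule exI[of _ "\<lambda>p v. 0"]) (auto intro: smooth_class.const)
next
  case (flat k c i d)
  let ?q = "\<lambda>s. (flat (k + 2) (c * s + d) + (- of_nat k) * flat (k + 1) (c * s + d)) * c"
  have q: "((\<lambda>s. flat k (c * s + d)) has_real_derivative ?q s) (at s)" for s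
  proof -
    have "((\<lambda>s. c * s + d) has_real_derivative c) (at s)"
      by (auto intro!: derivative_eq_intros)
    from DERIV_chain'[OF this DERIV_flat] show ?thesis by simp
  qed
  show ?case
  proof (intro exI conjI allI)
    show "((\<lambda>p. flat k (c * p$i + d)) has_derivative (\<lambda>v. ?q (p$i) * v$i)) (at p)" for p
      by (rule has_derivative_component_comp[OF q])
    show "(\<lambda>p. ?q (p$i) * v$i) \<in> smooth_class" for v
      by (intro smooth_class.intros)
  qed
next
  case (add f g)
  then obtain D E where D: "\<And>p. (f has_derivative D p) (at p)" "\<And>v. (\<lambda>p. D p v) \<in> smooth_class"
    and E: "\<And>p. (g has_derivative E p) (at p)" "\<And>v. (\<lambda>p. E p v) \<in> smooth_class"
    by metis
  show ?case
    by (rule exI[of _ "\<lambda>p v. D p v + E p v"])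
      (intro conjI allI has_derivative_add D E smooth_class.add)
next
  case (mult f g)
  then obtain D E where D: "\<And>p. (f has_derivative D p) (at p)" "\<And>v. (\<lambda>p. D p v) \<in> smooth_class"
    and E: "\<And>p. (g has_derivative E p) (at p)" "\<And>v. (\<lambda>p. E p v) \<in> smooth_class"
    by metis
  show ?case
    by (rule exI[of _ "\<lambda>p v. f p * E p v + D p v * g p"])
      (intro conjI allI has_derivative_mult D E smooth_class.add smooth_class.mult mult)
next
  case (primitive Q q i)
  show ?case
    by (rule exI[of _ "\<lambda>p v. q (p$i) * v$i"])
      (intro conjI allI has_derivative_component_comp primitive smooth_class.mult smooth_class.const)
qed

lemma smooth_class_Ck: "f \<in> smooth_class \<Longrightarrow> Ck n f"
proof (induction n arbitrary: f)
  case 0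
  then show ?case
    using smooth_class_has_derivative[OF 0] has_derivative_continuous
    by (fastforce intro!: continuous_at_imp_continuous_on)
next
  case (Suc n)
  obtain D where D: "\<And>p. (f has_derivative D p) (at p)" "\<And>v. (\<lambda>p. D p v) \<in> smooth_class"
    using smooth_class_has_derivative[OF Suc.prems] by metis
  then have "frechet_derivative f (at p) = D p" for p
    by (metis frechet_derivative_at)
  then show ?case
    using D Suc.IH by (auto simp: differentiable_def)
qed

lemma test_fun_smooth_class:
  assumes "f \<in> smooth_class" "compact K" "\<And>p. f p \<noteq> 0 \<Longrightarrow> p \<in> K"
  shows "test_fun f"
proof -
  have "closure {p. f p \<noteq> 0} \<subseteq> K"
    by (rule closure_minimal) (use assms compact_imp_closed in auto)
  then have "compact (closure {p. f p \<noteq> 0})"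
    by (metis assms(2) closed_closure compact_Int_closed inf.absorb_iff2)
  then show ?thesis
    unfolding test_fun_def using smooth_class_Ck assms(1) by blast
qed

text \<open>Two mirrored copies of \<open>flat 0\<close> cut off at c and d. The scale is
  \<open>Suc n\<close> because scale 0 would give the zero function; with growing n the bumps
  approach the indicator of the open interval.\<close>

definition bump1 :: "nat \<Rightarrow> real \<Rightarrow> real \<Rightarrow> real \<Rightarrow> real" where
  "bump1 n c d x = flat 0 (of_nat (Suc n) * (x - c)) * flat 0 (of_nat (Suc n) * (d - x))"

lemma bump1_bounds: "0 \<le> bump1 n c d x" "bump1 n c d x \<le> 1"
  using flat_0_bounds by (auto simp: bump1_def intro!: mult_nonneg_nonneg mult_le_one)

lemma bump1_eq_0: "x \<le> c \<or> d \<le> x \<Longrightarrow> bump1 n c d x = 0"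
  by (auto simp: bump1_def flat_def mult_le_0_iff zero_less_mult_iff)

lemma continuous_on_bump1 [continuous_intros]:
  "continuous_on S f \<Longrightarrow> continuous_on S (\<lambda>x. bump1 n c d (f x))"
  unfolding bump1_def by (intro continuous_intros)

lemma bump1_differentiable: "bump1 n c d differentiable (at x)"
proof -
  have "(\<lambda>x. flat 0 (r * x + s)) differentiable (at x)" for r s
  proof -
    have "((\<lambda>x. r * x + s) has_real_derivative r) (at x)"
      by (auto intro!: derivative_eq_intros)
    from DERIV_chain'[OF this DERIV_flat] show ?thesis
      by (auto simp: real_differentiable_def)
  qed
  from differentiable_mult[OF this[of "of_nat (Suc n)" "- of_nat (Suc n) * c"]
      this[of "- of_nat (Suc n)" "of_nat (Suc n) * d"]]
  show ?thesis
    by (simp add: bump1_def[abs_def] algebra_simps del: of_nat_Suc)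
qed

lemma bump1_tendsto: "(\<lambda>n. bump1 n c d x) \<longlonglongrightarrow> indicator {c<..<d} x"
proof (cases "c < x \<and> x < d")
  case True
  have "(\<lambda>n. bump1 n c d x) \<longlonglongrightarrow> 1 * 1"
    unfolding bump1_def by (intro tendsto_mult flat_tendsto_one) (use True in auto)
  then show ?thesis using True by simp
next
  case False
  then have "bump1 n c d x = 0" for n by (intro bump1_eq_0) auto
  then show ?thesis using False by simp
qed

lemma bump1_smooth_class: "(\<lambda>p. bump1 n c d (p$i + e)) \<in> smooth_class"
proof -
  have "(\<lambda>p. flat 0 (of_nat (Suc n) * p$i + of_nat (Suc n) * (e - c)) *
      flat 0 (- of_nat (Suc n) * p$i + of_nat (Suc n) * (d - e))) \<in> smooth_class"
    by (intro smooth_class.intros)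
  then show ?thesis
    unfolding bump1_def by (simp add: algebra_simps del: of_nat_Suc)
qed

definition bump3 :: "nat \<Rightarrow> real^3 \<Rightarrow> real^3 \<Rightarrow> real^3 \<Rightarrow> real" where
  "bump3 n l u p = bump1 n (l$1) (u$1) (p$1) * bump1 n (l$2) (u$2) (p$2) * bump1 n (l$3) (u$3) (p$3)"

lemma bump3_bounds: "0 \<le> bump3 n l u p" "bump3 n l u p \<le> 1"
  using bump1_bounds by (auto simp: bump3_def intro!: mult_nonneg_nonneg mult_le_one)

lemma bump3_eq_0: "p \<notin> box l u \<Longrightarrow> bump3 n l u p = 0"
  by (auto simp: bump3_def mem_box_cart forall_3 intro!: bump1_eq_0)

lemma bump3_le_indicator: "bump3 n l u p \<le> indicator (box l u) p"
  using bump3_bounds[of n l u p] bump3_eq_0[of p l u n] by (cases "p \<in> box l u") auto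

lemma continuous_on_bump3 [continuous_intros]:
  "continuous_on S f \<Longrightarrow> continuous_on S (\<lambda>x. bump3 n l u (f x))"
  unfolding bump3_def by (intro continuous_intros)

lemma bump3_tendsto: "(\<lambda>n. bump3 n l u p) \<longlonglongrightarrow> indicator (box l u) p"
proof -
  have "(\<lambda>n. bump3 n l u p) \<longlonglongrightarrow>
      indicator {l$1<..<u$1} (p$1) * indicator {l$2<..<u$2} (p$2) * indicator {l$3<..<u$3} (p$3)"
    unfolding bump3_def by (intro tendsto_mult bump1_tendsto)
  also have "indicator {l$1<..<u$1} (p$1) * indicator {l$2<..<u$2} (p$2) * indicator {l$3<..<u$3} (p$3)
      = (indicator (box l u) p :: real)"
    by (auto simp: indicator_def mem_box_cart forall_3)
  finally show ?thesis .
qed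

lemma bump3_smooth_class: "bump3 n l u \<in> smooth_class"
proof -
  have "(\<lambda>p. bump1 n (l$1) (u$1) (p$1 + 0) * bump1 n (l$2) (u$2) (p$2 + 0)
      * bump1 n (l$3) (u$3) (p$3 + 0)) \<in> smooth_class"
    by (intro smooth_class.mult bump1_smooth_class)
  then show ?thesis
    by (simp add: bump3_def[abs_def])
qed

lemma test_fun_bump3: "test_fun (bump3 n l u)"
  by (rule test_fun_smooth_class[OF bump3_smooth_class compact_cbox[of l u]])
    (use bump3_eq_0 box_subset_cbox in blast)

section \<open>Shears and functions with vanishing test integrals\<close>

text \<open>For fixed s the shear is a translation in p, which preserves Lebesgue measure; Tonelli
  with p as the inner variable does the rest.\<close>

lemma distr_shear:
  fixes e :: "'a::euclidean_space"
  shows "distr (lborel \<Otimes>\<^sub>M lborel) (lborel \<Otimes>\<^sub>M lborel) (\<lambda>(p, s::real). (p + s *\<^sub>R e, s))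
    = lborel \<Otimes>\<^sub>M lborel" (is "distr ?M ?M ?T = ?M")
proof (rule measure_eqI)
  have T [measurable]: "?T \<in> measurable ?M ?M"
    by measurable
  fix X assume "X \<in> sets (distr ?M ?M ?T)"
  then have X [measurable]: "X \<in> sets ?M" by simp
  have "emeasure (distr ?M ?M ?T) X = (\<integral>\<^sup>+z. indicator X z \<partial>distr ?M ?M ?T)"
    by (rule nn_integral_indicator[symmetric]) (simp only: sets_distr X)
  also have "\<dots> = (\<integral>\<^sup>+z. indicator X (?T z) \<partial>?M)"
    by (rule nn_integral_distr) measurable
  also have "\<dots> = (\<integral>\<^sup>+s. (\<integral>\<^sup>+p. indicator X (p + s *\<^sub>R e, s) \<partial>lborel) \<partial>lborel)"
    by (subst lborel_pair.nn_integral_snd[symmetric]) auto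
  also have "\<dots> = (\<integral>\<^sup>+s. (\<integral>\<^sup>+p. indicator X (p, s) \<partial>lborel) \<partial>lborel)"
  proof (rule nn_integral_cong)
    fix s :: real
    have "(\<integral>\<^sup>+p. indicator X (p, s) \<partial>lborel)
        = (\<integral>\<^sup>+p. indicator X (p, s) \<partial>distr lborel borel ((+) (s *\<^sub>R e)))"
      by (simp only: lborel_distr_plus)
    also have "\<dots> = (\<integral>\<^sup>+p. indicator X (p + s *\<^sub>R e, s) \<partial>lborel)"
      by (subst nn_integral_distr) (auto simp: add.commute)
    finally show "(\<integral>\<^sup>+p. indicator X (p + s *\<^sub>R e, s) \<partial>lborel) = (\<integral>\<^sup>+p. indicator X (p, s) \<partial>lborel)"
      by simp
  qed
  also have "\<dots> = (\<integral>\<^sup>+z. indicator X z \<partial>?M)"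
    by (rule lborel_pair.nn_integral_snd) measurable
  also have "\<dots> = emeasure ?M X"
    by (rule nn_integral_indicator[OF X])
  finally show "emeasure (distr ?M ?M ?T) X = emeasure ?M X" .
qed simp

lemma shear_measurable:
  fixes e :: "'a::euclidean_space"
  shows "(\<lambda>(p, s::real). (p + s *\<^sub>R e, s)) \<in> measurable (lborel \<Otimes>\<^sub>M lborel) (lborel \<Otimes>\<^sub>M lborel)"
  by measurable

lemma nn_integral_shear:
  fixes e :: "'a::euclidean_space"
  assumes [measurable]: "case_prod H \<in> borel_measurable (lborel \<Otimes>\<^sub>M lborel)"
  shows "(\<integral>\<^sup>+p. \<integral>\<^sup>+s. H (p + s *\<^sub>R e) s \<partial>lborel \<partial>lborel) = (\<integral>\<^sup>+s. \<integral>\<^sup>+p. H p s \<partial>lborel \<partial>lborel)"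
proof -
  let ?M = "lborel \<Otimes>\<^sub>M lborel :: ('a \<times> real) measure"
  have "(\<integral>\<^sup>+p. \<integral>\<^sup>+s. H (p + s *\<^sub>R e) s \<partial>lborel \<partial>lborel)
      = (\<integral>\<^sup>+z. case_prod H ((\<lambda>(p, s). (p + s *\<^sub>R e, s)) z) \<partial>?M)"
    by (subst lborel.nn_integral_fst[symmetric]) (auto simp: case_prod_unfold)
  also have "\<dots> = (\<integral>\<^sup>+z. case_prod H z \<partial>distr ?M ?M (\<lambda>(p, s). (p + s *\<^sub>R e, s)))"
    by (rule nn_integral_distr[symmetric]) auto
  also have "\<dots> = (\<integral>\<^sup>+z. case_prod H z \<partial>?M)"
    by (simp only: distr_shear)
  also have "\<dots> = (\<integral>\<^sup>+s. \<integral>\<^sup>+p. H p s \<partial>lborel \<partial>lborel)"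
    by (subst lborel_pair.nn_integral_snd[symmetric]) auto
  finally show ?thesis .
qed

lemma integrable_shear:
  fixes e :: "'a::euclidean_space" and H :: "'a \<Rightarrow> real \<Rightarrow> real"
  assumes "integrable (lborel \<Otimes>\<^sub>M lborel) (case_prod H)"
  shows "integrable (lborel \<Otimes>\<^sub>M lborel) (\<lambda>(p, s). H (p + s *\<^sub>R e) s)"
proof -
  let ?M = "lborel \<Otimes>\<^sub>M lborel :: ('a \<times> real) measure"
  have "integrable (distr ?M ?M (\<lambda>(p, s). (p + s *\<^sub>R e, s))) (case_prod H)"
    by (simp only: distr_shear assms)
  then have "integrable ?M (\<lambda>z. case_prod H ((\<lambda>(p, s). (p + s *\<^sub>R e, s)) z))"
    by (rule integrable_distr[OF shear_measurable])
  then show ?thesis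
    by (simp add: case_prod_unfold)
qed

text \<open>Trades an integral along the line through p for one with p held fixed, where only the
  explicit dependence of \<open>H\<close> on s remains to be integrated.\<close>

lemma integral_shear:
  fixes e :: "'a::euclidean_space" and H :: "'a \<Rightarrow> real \<Rightarrow> real"
  assumes H: "integrable (lborel \<Otimes>\<^sub>M lborel) (case_prod H)"
  shows "(\<integral>p. \<integral>s. H (p + s *\<^sub>R e) s \<partial>lborel \<partial>lborel) = (\<integral>p. \<integral>s. H p s \<partial>lborel \<partial>lborel)"
proof -
  let ?M = "lborel \<Otimes>\<^sub>M lborel :: ('a \<times> real) measure"
  have [measurable]: "case_prod H \<in> borel_measurable ?M"
    using H by auto
  have "(\<integral>p. \<integral>s. H (p + s *\<^sub>R e) s \<partial>lborel \<partial>lborel)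
      = (\<integral>z. case_prod H ((\<lambda>(p, s). (p + s *\<^sub>R e, s)) z) \<partial>?M)"
    by (subst lborel_pair.integral_fst'[symmetric])
      (use integrable_shear[OF H, of e] in \<open>auto simp: case_prod_unfold\<close>)
  also have "\<dots> = (\<integral>z. case_prod H z \<partial>distr ?M ?M (\<lambda>(p, s). (p + s *\<^sub>R e, s)))"
    by (rule integral_distr[symmetric]) auto
  also have "\<dots> = (\<integral>z. case_prod H z \<partial>?M)"
    by (simp only: distr_shear)
  also have "\<dots> = (\<integral>p. \<integral>s. H p s \<partial>lborel \<partial>lborel)"
    by (subst lborel_pair.integral_fst'[symmetric]) (use H in auto)
  finally show ?thesis .
qed

lemma integrable_product_bound:
  fixes H :: "'a::euclidean_space \<Rightarrow> real \<Rightarrow> real"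
  assumes k: "integrable lborel (k :: 'a \<Rightarrow> real)"
    and H [measurable]: "case_prod H \<in> borel_measurable (lborel \<Otimes>\<^sub>M lborel)"
    and bound: "\<And>p s. \<bar>H p s\<bar> \<le> indicator {c..d} s * \<bar>k p\<bar>"
  shows "integrable (lborel \<Otimes>\<^sub>M lborel) (case_prod H)"
proof (rule Bochner_Integration.integrable_bound)
  have [measurable]: "k \<in> borel_measurable borel" using k by auto
  show "integrable (lborel \<Otimes>\<^sub>M lborel) (\<lambda>(p, s). indicator {c..d} s * \<bar>k p\<bar>)"
  proof (rule lborel_pair.Fubini_integrable)
    show "AE p in lborel. integrable lborel (\<lambda>s. case (p, s) of (p, s) \<Rightarrow> indicator {c..d} s * \<bar>k p\<bar>)"
      by (auto intro!: AE_I2 integrable_real_indicator simp: emeasure_lborel_Icc_eq)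
    have "integrable lborel (\<lambda>p. \<bar>k p\<bar> * measure lborel {c..d})"
      using k by (intro integrable_mult_left) auto
    then show "integrable lborel (\<lambda>p. \<integral>s. norm (case (p, s) of (p, s) \<Rightarrow> indicator {c..d} s * \<bar>k p\<bar>) \<partial>lborel)"
      by (simp add: abs_mult mult.commute)
  qed measurable
qed (use bound in \<open>auto intro!: AE_I2\<close>)

text \<open>Open boxes are an intersection-stable generator of the Borel sets, so the vanishing of
  integrals spreads to all Borel sets; then k and 0 are densities of the same set function.\<close>

lemma AE_zero_if_box_integrals_zero:
  fixes k :: "'a::euclidean_space \<Rightarrow> real"
  assumes k: "integrable lborel k"
    and box: "\<And>l u. (LINT p:box l u|lborel. k p) = 0"
  shows "AE p in lborel. k p = 0"
proof -
  have set_int: "set_integrable lborel A k" if "A \<in> sets borel" for A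
    using k that unfolding set_integrable_def by (intro integrable_mult_indicator) auto
  \<comment> \<open>The complement step of the induction subtracts from the integral over the whole
    space, which is not itself a box.\<close>
  have UNIV: "(LINT p:UNIV|lborel. k p) = 0"
  proof -
    have "(\<lambda>n. LINT p:box (- (real n *\<^sub>R One)) (real n *\<^sub>R One)|lborel. k p) \<longlonglongrightarrow>
        (LINT p:(\<Union>n. box (- (real n *\<^sub>R One)) (real n *\<^sub>R One))|lborel. k p)"
    proof (intro set_integral_cont_up set_int)
      show "incseq (\<lambda>n. box (- (real n *\<^sub>R One)) (real n *\<^sub>R One :: 'a))"
        unfolding incseq_def by (intro allI impI subset_box_imp) auto
    qed auto
    then show ?thesis
      by (simp add: box UN_box_eq_UNIV LIMSEQ_const_iff)
  qed
  have all: "(LINT p:A|lborel. k p) = 0" if "A \<in> sets borel" for A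
  proof -
    have "Int_stable (range (\<lambda>(a, b). box a b :: 'a set))"
      by (auto simp: Int_stable_def box_Int_box)
    moreover have "range (\<lambda>(a, b). box a b :: 'a set) \<subseteq> Pow UNIV" by auto
    moreover have "A \<in> sigma_sets UNIV (range (\<lambda>(a, b). box a b))"
      using that unfolding borel_eq_box by simp
    ultimately show ?thesis
    proof (induction rule: sigma_sets_induct_disjoint)
      case (basic A)
      then show ?case using box by auto
    next
      case empty
      then show ?case by (simp add: set_lebesgue_integral_def)
    next
      case (compl A)
      then have A: "A \<in> sets borel" by (simp add: borel_eq_box)
      then have "(LINT p:A \<union> (UNIV - A)|lborel. k p)
          = (LINT p:A|lborel. k p) + (LINT p:UNIV - A|lborel. k p)"
        by (intro set_integral_Un set_int) auto
      then show ?case using compl UNIV by simp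
    next
      case (union A)
      then have A: "\<And>i. A i \<in> sets borel" by (auto simp: borel_eq_box)
      then have "(LINT p:(\<Union>i. A i)|lborel. k p) = (\<Sum>i. LINT p:A i|lborel. k p)"
        using union(1) by (intro lebesgue_integral_countable_add set_int)
          (auto simp: disjoint_family_on_def)
      then show ?case using union by simp
    qed
  qed
  show ?thesis
    by (rule density_unique_real) (use k all in \<open>auto simp: set_lebesgue_integral_def\<close>)
qed

text \<open>The fundamental lemma of the calculus of variations for this family of bumps: they stay
  below 1 and converge to indicators of boxes, so dominated convergence reduces it to box
  integrals.\<close>

lemma AE_zero_if_bump_integrals_zero:
  fixes k :: "real^3 \<Rightarrow> real"
  assumes k: "set_integrable lborel (box l u) k"
    and bump: "\<And>n l' u'. box l' u' \<subseteq> box l u \<Longrightarrow> (\<integral>p. k p * bump3 n l' u' p \<partial>lborel) = 0"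
  shows "AE p in lborel. p \<in> box l u \<longrightarrow> k p = 0"
proof -
  define K where "K p = indicator (box l u) p * k p" for p
  have K: "integrable lborel K"
    using k by (simp add: set_integrable_def K_def[abs_def])
  then have [measurable]: "K \<in> borel_measurable borel" by auto
  have [measurable]: "bump3 n l' u' \<in> borel_measurable borel" for n l' u'
    by (intro borel_measurable_continuous_onI continuous_intros)
  have "AE p in lborel. K p = 0"
  proof (rule AE_zero_if_box_integrals_zero[OF K])
    \<comment> \<open>An arbitrary box may stick out of \<open>box l u\<close>; the intersection is
      again a box, and \<open>K\<close> vanishes outside it.\<close>
    fix l'' u'' :: "real^3"
    obtain l' u' where b: "box l'' u'' \<inter> box l u = box l' u'"
      using box_Int_box by blast
    then have sub: "box l' u' \<subseteq> box l u" by blast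
    have "(\<lambda>n. \<integral>p. K p * bump3 n l' u' p \<partial>lborel) \<longlonglongrightarrow> (\<integral>p. K p * indicator (box l' u') p \<partial>lborel)"
    proof (rule integral_dominated_convergence)
      show "integrable lborel (\<lambda>p. \<bar>K p\<bar>)" using K by simp
      show "AE p in lborel. (\<lambda>n. K p * bump3 n l' u' p) \<longlonglongrightarrow> K p * indicator (box l' u') p"
        by (intro AE_I2 tendsto_intros bump3_tendsto)
      show "AE p in lborel. norm (K p * bump3 n l' u' p) \<le> \<bar>K p\<bar>" for n
        by (intro AE_I2) (simp add: abs_mult bump3_bounds mult_left_le)
    qed auto
    moreover have "(\<integral>p. K p * bump3 n l' u' p \<partial>lborel) = 0" for n
    proof -
      have "K p * bump3 n l' u' p = k p * bump3 n l' u' p" for p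
        using subsetD[OF sub, of p] bump3_eq_0[of p l' u' n]
        by (cases "p \<in> box l' u'") (simp_all add: K_def)
      then show ?thesis using bump[OF sub, of n] by (simp only:)
    qed
    ultimately have 0: "(\<integral>p. K p * indicator (box l' u') p \<partial>lborel) = 0"
      by (simp add: LIMSEQ_const_iff)
    have "indicator (box l'' u'') p *\<^sub>R K p = K p * indicator (box l' u') p" for p
      unfolding b[symmetric] K_def by (cases "p \<in> box l u") (simp_all add: indicator_inter_arith)
    then show "(LINT p:box l'' u''|lborel. K p) = 0"
      using 0 unfolding set_lebesgue_integral_def by (simp only:)
  qed
  then show ?thesis by eventually_elim (simp add: K_def indicator_eq_0_iff)
qed

section \<open>Poincare inequality for weak gradients\<close>

lemma continuous_antiderivative:
  fixes q :: "real \<Rightarrow> real"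
  assumes "continuous_on UNIV q"
  obtains Q where "\<And>s. (Q has_real_derivative q s) (at s)"
proof -
  have "\<exists>F. \<forall>x. (-\<infinity>::ereal) < x \<longrightarrow> x < (\<infinity>::ereal) \<longrightarrow> (F has_vector_derivative q x) (at x)"
    by (rule einterval_antiderivative) (use assms in \<open>auto simp: continuous_on_eq_continuous_at\<close>)
  then show ?thesis
    using that by (auto simp: has_real_derivative_iff_has_vector_derivative)
qed

text \<open>The shifted copy of the bump makes the primitive compactly supported; for large L it lies above the layer,
  where functions admissible in the variational problem vanish.\<close>

lemma bump3_vertical_primitive:
  assumes "0 \<le> L"
  obtains \<Psi> where "test_fun \<Psi>"
    and "\<And>p. \<Psi> p = (\<integral>s. indicator {0..L} s * bump3 n l u (p - s *\<^sub>R axis 3 1) \<partial>lborel)"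
    and "\<And>p. frechet_derivative \<Psi> (at p) (axis 3 1) = bump3 n l u p - bump3 n l u (p - L *\<^sub>R axis 3 1)"
proof -
  define b where "b i = bump1 n (l$i) (u$i)" for i :: 3
  have b_cont: "continuous_on UNIV (b i)" for i
    unfolding b_def by (intro continuous_intros)
  obtain Q where Q: "\<And>s. (Q has_real_derivative b 3 s) (at s)"
    using continuous_antiderivative[OF b_cont[of 3]] by blast
  \<comment> \<open>Two forms of the same function are used: the difference of primitives yields the
    derivative, the integral form in \<open>\<Gamma>_int\<close> yields the support and the later
    exchange of integrals.\<close>
  define \<Gamma> where "\<Gamma> z = Q z - Q (z - L)" for z
  define \<Psi> where "\<Psi> p = b 1 (p$1) * b 2 (p$2) * \<Gamma> (p$3)" for p :: "real^3"
  have shift: "((\<lambda>s. Q (s + c)) has_real_derivative b 3 (s + c)) (at s)" for s c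
    using DERIV_shift[of Q "b 3 (s + c)" s c] Q by simp
  have \<Gamma>': "(\<Gamma> has_real_derivative (b 3 s - b 3 (s - L))) (at s)" for s
    unfolding \<Gamma>_def using shift[of "-L" s] by (auto intro!: derivative_eq_intros Q)
  have \<Gamma>_int: "\<Gamma> z = (\<integral>s. indicator {0..L} s * b 3 (z - s) \<partial>lborel)" for z
  proof -
    have "(\<integral>s. indicator {0..L} s *\<^sub>R b 3 (z - s) \<partial>lborel) = - Q (z - L) - - Q (z - 0)"
    proof (rule integral_FTC_atLeastAtMost[OF assms])
      show "((\<lambda>s. - Q (z - s)) has_vector_derivative b 3 (z - s)) (at s within {0..L})" for s
      proof -
        have "((\<lambda>s. - Q (z - s)) has_real_derivative - (b 3 (z - s) * - 1)) (at s within {0..L})"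
          by (rule DERIV_minus, rule DERIV_chain2[OF Q]) (auto intro!: derivative_eq_intros)
        then show ?thesis
          by (simp add: has_real_derivative_iff_has_vector_derivative)
      qed
      show "continuous_on {0..L} (\<lambda>s. b 3 (z - s))"
        unfolding b_def by (intro continuous_intros)
    qed
    then show ?thesis by (simp add: \<Gamma>_def)
  qed
  have "\<Psi> \<in> smooth_class"
  proof -
    have b_class: "(\<lambda>p. b i (p$i)) \<in> smooth_class" for i
      using bump1_smooth_class[of n "l$i" "u$i" i 0] by (simp add: b_def)
    have "(\<lambda>p::real^3. b 3 (p$3 + c)) \<in> smooth_class" for c
      using bump1_smooth_class[of n "l$3" "u$3" 3 c] by (simp add: b_def)
    \<comment> \<open>\<open>Q\<close> is known only through its derivative, a bump; the constructor
      \<open>primitive\<close> exists to admit this function.\<close>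
    from smooth_class.primitive[OF shift this]
    have Q_class: "(\<lambda>p::real^3. Q (p$3 + c)) \<in> smooth_class" for c .
    have "(\<lambda>p. b 1 (p$1) * b 2 (p$2) * (Q (p$3 + 0) + (-1) * Q (p$3 + (-L)))) \<in> smooth_class"
      by (intro smooth_class.mult smooth_class.add smooth_class.const b_class Q_class)
    then show ?thesis by (simp add: \<Psi>_def[abs_def] \<Gamma>_def)
  qed
  have \<Psi>_int: "\<Psi> p = (\<integral>s. indicator {0..L} s * bump3 n l u (p - s *\<^sub>R axis 3 1) \<partial>lborel)" for p
  proof -
    have "indicator {0..L} s * bump3 n l u (p - s *\<^sub>R axis 3 1)
        = b 1 (p$1) * b 2 (p$2) * (indicator {0..L} s * b 3 (p$3 - s))" for s
      by (simp add: bump3_def b_def axis_def)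
    then show ?thesis
      unfolding \<Psi>_def \<Gamma>_int by (simp only: integral_mult_right_zero)
  qed
  have "test_fun \<Psi>"
  proof (rule test_fun_smooth_class[OF \<open>\<Psi> \<in> smooth_class\<close> compact_cbox[of l "u + L *\<^sub>R axis 3 1"]])
    fix p assume "\<Psi> p \<noteq> 0"
    \<comment> \<open>The support is read off the integral form: a nonzero integral needs a nonzero
      integrand somewhere.\<close>
    have "\<exists>s\<in>{0..L}. bump3 n l u (p - s *\<^sub>R axis 3 1) \<noteq> 0"
    proof (rule ccontr)
      assume "\<not> ?thesis"
      then have "indicator {0..L} s * bump3 n l u (p - s *\<^sub>R axis 3 1) = 0" for s
        by (auto simp: indicator_def)
      then have "\<Psi> p = 0" unfolding \<Psi>_int by (simp only: Bochner_Integration.integral_zero)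
      then show False using \<open>\<Psi> p \<noteq> 0\<close> by simp
    qed
    then obtain s where s: "0 \<le> s" "s \<le> L" "p - s *\<^sub>R axis 3 1 \<in> box l u"
      using bump3_eq_0 by fastforce
    then show "p \<in> cbox l (u + L *\<^sub>R axis 3 1)"
      by (auto simp: mem_box_cart axis_def forall_3)
  qed
  moreover have "frechet_derivative \<Psi> (at p) (axis 3 1)
      = bump3 n l u p - bump3 n l u (p - L *\<^sub>R axis 3 1)" for p
  proof -
    have "b i differentiable (at s)" for i s
      unfolding b_def by (rule bump1_differentiable)
    then obtain d1 d2 where d: "(b 1 has_real_derivative d1) (at (p$1))" "(b 2 has_real_derivative d2) (at (p$2))"
      unfolding real_differentiable_def by blast
    have "(\<Psi> has_derivative (\<lambda>v. b 1 (p$1) * b 2 (p$2) * ((b 3 (p$3) - b 3 (p$3 - L)) * v$3)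
        + (b 1 (p$1) * (d2 * v$2) + d1 * v$1 * b 2 (p$2)) * \<Gamma> (p$3))) (at p)"
      unfolding \<Psi>_def
      by (intro has_derivative_mult has_derivative_component_comp d \<Gamma>')
    from frechet_derivative_at[OF this, symmetric] show ?thesis
      by (simp add: bump3_def b_def axis_def algebra_simps)
  qed
  ultimately show ?thesis using that \<Psi>_int by blast
qed

lemma L2loc_integrable:
  assumes f: "L2loc f" and K: "compact K"
  shows "integrable lborel (\<lambda>p. indicator K p * f p)"
    and "integrable lborel (\<lambda>p. indicator K p * (f p)\<^sup>2)"
proof -
  have [measurable]: "f \<in> borel_measurable borel" using f by (simp add: L2loc_def)
  have [measurable]: "K \<in> sets borel" using K by (simp add: compact_imp_closed)
  show sq: "integrable lborel (\<lambda>p. indicator K p * (f p)\<^sup>2)"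
    using f K by (simp add: L2loc_def set_integrable_def)
  have "integrable lborel (indicator K :: real^3 \<Rightarrow> real)"
    using K by (intro integrable_real_indicator emeasure_compact_finite) (auto simp: compact_imp_closed)
  then have "integrable lborel (\<lambda>p. indicator K p + indicator K p * (f p)\<^sup>2)"
    using sq by simp
  then show "integrable lborel (\<lambda>p. indicator K p * f p)"
  proof (rule Bochner_Integration.integrable_bound)
    have "\<bar>x\<bar> \<le> 1 + x\<^sup>2" for x :: real
      using zero_le_power2[of "\<bar>x\<bar> - 1 / 2"] by (simp add: power2_diff power_divide)
    then show "AE p in lborel. norm (indicator K p * f p) \<le> norm (indicator K p + indicator K p * (f p)\<^sup>2)"
      by (intro AE_I2) (auto simp: indicator_def intro: order_trans[OF _ abs_ge_self])
  qed measurable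
qed

text \<open>Outside the box the nonnegative bump attains its minimum 0. Unlike local constancy, this
  argument also covers the boundary points of the box.\<close>

lemma frechet_derivative_bump3_outside:
  assumes "p \<notin> box l u"
  shows "frechet_derivative (bump3 n l u) (at p) = (\<lambda>v. 0)"
proof -
  obtain D where D: "(bump3 n l u has_derivative D) (at p)"
    using smooth_class_has_derivative[OF bump3_smooth_class] by blast
  have "D = (\<lambda>v. 0)"
    by (rule differential_zero_maxmin[OF _ open_UNIV D])
      (use assms in \<open>auto simp: bump3_eq_0 bump3_bounds\<close>)
  then show ?thesis
    using frechet_derivative_at[OF D] by simp
qed

text \<open>The weak gradient is known only through test integrals, so its vanishing above the layer
  has to be recovered from bumps supported there, against which f contributes nothing.\<close>

lemma H1_adm_gradient_zero_above:
  assumes fg: "H1_adm a b f g" and l: "1 \<le> l$3"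
  shows "AE p in lborel. p \<in> box l u \<longrightarrow> g p $ 3 = 0"
proof (rule AE_zero_if_bump_integrals_zero)
  have "L2loc (\<lambda>p. g p $ 3)" using fg by (simp add: H1_adm_def)
  then have "set_integrable lborel (cbox l u) (\<lambda>p. g p $ 3)"
    using L2loc_integrable(1)[of _ "cbox l u"] by (simp add: set_integrable_def)
  then show "set_integrable lborel (box l u) (\<lambda>p. g p $ 3)"
    by (rule set_integrable_subset) (auto simp: box_subset_cbox)
  fix n and l' u' :: "real^3" assume sub: "box l' u' \<subseteq> box l u"
  have "f p * frechet_derivative (bump3 n l' u') (at p) (axis 3 1) = 0" for p
  proof (cases "p \<in> box l' u'")
    case True
    then have "p \<in> box l u" using sub by blast
    then have "1 < \<bar>p$3\<bar>" using l by (simp add: mem_box_cart) (smt (verit))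
    then show ?thesis using fg by (simp add: H1_adm_def)
  qed (simp add: frechet_derivative_bump3_outside)
  moreover have "(\<integral>p. f p * frechet_derivative (bump3 n l' u') (at p) (axis 3 1) \<partial>lborel)
      = - (\<integral>p. g p $ 3 * bump3 n l' u' p \<partial>lborel)"
    using fg test_fun_bump3 by (simp add: H1_adm_def weak_grad_def)
  ultimately show "(\<integral>p. g p $ 3 * bump3 n l' u' p \<partial>lborel) = 0"
    by (simp only: Bochner_Integration.integral_zero)
qed

text \<open>Cauchy-Schwarz against the indicator of [0, L], which is split off as a second factor.
  Nonnegative integrals on the right allow an infinite value.\<close>

lemma ennreal_integral_square_le:
  assumes [measurable]: "h \<in> borel_measurable borel" and L: "0 \<le> L"
  shows "ennreal ((\<integral>s. indicator {0..L} s * h s \<partial>lborel)\<^sup>2)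
    \<le> ennreal L * (\<integral>\<^sup>+s. indicator {0..L} s * ennreal ((h s)\<^sup>2) \<partial>lborel)"
proof -
  let ?I = "\<integral>s. indicator {0..L} s * h s \<partial>lborel"
  have "ennreal \<bar>?I\<bar> \<le> (\<integral>\<^sup>+s. indicator {0..L} s * ennreal \<bar>h s\<bar> \<partial>lborel)"
  \<comment> \<open>If the integrand is not integrable, its Bochner integral is 0 by convention and
    the bound is trivial.\<close>
  proof (cases "integrable lborel (\<lambda>s. indicator {0..L} s * h s)")
    case True
    have "ennreal (norm ?I) \<le> (\<integral>\<^sup>+s. ennreal (norm (indicator {0..L} s * h s)) \<partial>lborel)"
      by (rule integral_norm_bound_ennreal[OF True])
    also have "\<dots> = (\<integral>\<^sup>+s. indicator {0..L} s * ennreal \<bar>h s\<bar> \<partial>lborel)"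
      by (intro nn_integral_cong) (auto simp: indicator_def)
    finally show ?thesis by simp
  qed (simp add: not_integrable_integral_eq)
  then have "(ennreal \<bar>?I\<bar>)\<^sup>2 \<le> (\<integral>\<^sup>+s. indicator {0..L} s * (indicator {0..L} s * ennreal \<bar>h s\<bar>) \<partial>lborel)\<^sup>2"
    by (intro power_mono) (simp_all add: mult.assoc[symmetric] indicator_inter_arith[symmetric])
  also have "\<dots> \<le> (\<integral>\<^sup>+s. (indicator {0..L} s)\<^sup>2 \<partial>lborel)
      * (\<integral>\<^sup>+s. (indicator {0..L} s * ennreal \<bar>h s\<bar>)\<^sup>2 \<partial>lborel)"
    by (rule Cauchy_Schwarz_nn_integral) measurable
  also have "(\<integral>\<^sup>+s. (indicator {0..L} s)\<^sup>2 \<partial>lborel) = ennreal L"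
  proof -
    have "(indicator {0..L} s :: ennreal)\<^sup>2 = indicator {0..L} s" for s
      by (simp add: indicator_def)
    then show ?thesis using L by simp
  qed
  also have "(\<integral>\<^sup>+s. (indicator {0..L} s * ennreal \<bar>h s\<bar>)\<^sup>2 \<partial>lborel)
      = (\<integral>\<^sup>+s. indicator {0..L} s * ennreal ((h s)\<^sup>2) \<partial>lborel)"
    by (intro nn_integral_cong) (auto simp: indicator_def ennreal_power)
  finally show ?thesis by (simp add: ennreal_power)
qed

text \<open>Averaging upwards is adjoint to averaging downwards. The weight \<theta> lives on a
  bounded box, so local square integrability of g suffices for integrability on the product.\<close>

lemma integrable_vertical_average:
  fixes \<theta> g :: "real^3 \<Rightarrow> real"
  assumes g: "L2loc g" and [measurable]: "\<theta> \<in> borel_measurable borel"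
    and \<theta>: "\<And>p. \<bar>\<theta> p\<bar> \<le> indicator (box l u) p" and L: "0 \<le> L"
  defines "J \<equiv> \<lambda>p. \<integral>s. indicator {0..L} s * g (p + s *\<^sub>R axis 3 1) \<partial>lborel"
  shows "integrable lborel (\<lambda>p. \<theta> p * J p)"
    and "(\<integral>p. \<theta> p * J p \<partial>lborel)
      = (\<integral>p. g p * (\<integral>s. indicator {0..L} s * \<theta> (p - s *\<^sub>R axis 3 1) \<partial>lborel) \<partial>lborel)"
proof -
  let ?e = "axis 3 1 :: real^3"
  have [measurable]: "g \<in> borel_measurable borel" using g by (simp add: L2loc_def)
  define K where "K = cbox l (u + L *\<^sub>R ?e)"
  \<comment> \<open>The shift is put on \<theta>, so that \<open>H\<close> is dominated by |g| on
    one compact set \<open>K\<close> for all s; the shear then moves it onto g.\<close>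
  define H where "H p s = indicator {0..L} s * (\<theta> (p - s *\<^sub>R ?e) * g p)" for p s
  have H: "integrable (lborel \<Otimes>\<^sub>M lborel) (case_prod H)"
  proof (rule integrable_product_bound)
    show "integrable lborel (\<lambda>p. indicator K p * g p)"
      by (rule L2loc_integrable[OF g]) (simp add: K_def compact_cbox)
    show "case_prod H \<in> borel_measurable (lborel \<Otimes>\<^sub>M lborel)"
      unfolding H_def by measurable
    show "\<bar>H p s\<bar> \<le> indicator {0..L} s * \<bar>indicator K p * g p\<bar>" for p s
    proof (cases "0 \<le> s \<and> s \<le> L \<and> p - s *\<^sub>R ?e \<in> box l u")
      case True
      then have "p \<in> K"
        by (auto simp: K_def mem_box_cart axis_def forall_3)
      moreover have "\<bar>\<theta> (p - s *\<^sub>R ?e)\<bar> \<le> 1"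
        using \<theta>[of "p - s *\<^sub>R ?e"] True by simp
      ultimately show ?thesis
        using True by (simp add: H_def abs_mult mult_left_le_one_le)
    next
      case False
      then have "H p s = 0"
        using \<theta>[of "p - s *\<^sub>R ?e"] by (auto simp: H_def indicator_def)
      then show ?thesis by simp
    qed
  qed
  have shift: "H (p + s *\<^sub>R ?e) s = \<theta> p * (indicator {0..L} s * g (p + s *\<^sub>R ?e))" for p s
    by (simp add: H_def)
  have "integrable lborel (\<lambda>p. \<integral>s. H (p + s *\<^sub>R ?e) s \<partial>lborel)"
    using lborel_pair.integrable_fst'[OF integrable_shear[OF H, of ?e]] by simp
  then show "integrable lborel (\<lambda>p. \<theta> p * J p)"
    by (simp only: shift J_def integral_mult_right_zero)
  have "(\<integral>p. \<theta> p * J p \<partial>lborel) = (\<integral>p. \<integral>s. H (p + s *\<^sub>R ?e) s \<partial>lborel \<partial>lborel)"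
    by (simp only: shift J_def integral_mult_right_zero)
  also have "\<dots> = (\<integral>p. \<integral>s. H p s \<partial>lborel \<partial>lborel)"
    by (rule integral_shear[OF H])
  also have "\<dots> = (\<integral>p. \<integral>s. g p * (indicator {0..L} s * \<theta> (p - s *\<^sub>R ?e)) \<partial>lborel \<partial>lborel)"
    by (simp add: H_def mult_ac)
  finally show "(\<integral>p. \<theta> p * J p \<partial>lborel)
      = (\<integral>p. g p * (\<integral>s. indicator {0..L} s * \<theta> (p - s *\<^sub>R axis 3 1) \<partial>lborel) \<partial>lborel)"
    by (simp only: integral_mult_right_zero)
qed

text \<open>The shift 5 carries the range [-2, 2] of heights above the wall z = 1.\<close>

lemma H1_adm_eq_vertical_integral:
  assumes fg: "H1_adm a b f g" and l: "- 2 \<le> l$3" and u: "u$3 \<le> 2"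
  shows "AE p in lborel. p \<in> box l u \<longrightarrow>
    f p + (\<integral>s. indicator {0..5} s * g (p + s *\<^sub>R axis 3 1) $ 3 \<partial>lborel) = 0"
proof (rule AE_zero_if_bump_integrals_zero)
  let ?e = "axis 3 1 :: real^3"
  \<comment> \<open>\<open>J p\<close> stands for the increment of f from p to the point 5 units
    above it, where f is 0; hence the claim f + J = 0.\<close>
  define J where "J p = (\<integral>s. indicator {0..5} s * g (p + s *\<^sub>R ?e) $ 3 \<partial>lborel)" for p
  have f: "L2loc f" and g: "L2loc (\<lambda>p. g p $ 3)" using fg by (auto simp: H1_adm_def)
  then have [measurable]: "f \<in> borel_measurable borel" by (simp add: L2loc_def)
  have "set_integrable lborel (box l u) f"
    by (rule set_integrable_subset[of _ "cbox l u"])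
      (use L2loc_integrable(1)[OF f, of "cbox l u"] box_subset_cbox in \<open>auto simp: set_integrable_def\<close>)
  moreover have "set_integrable lborel (box l u) J"
    using integrable_vertical_average(1)[OF g, of "indicator (box l u)" l u 5]
    by (simp add: set_integrable_def J_def[abs_def])
  ultimately show "set_integrable lborel (box l u)
      (\<lambda>p. f p + (\<integral>s. indicator {0..5} s * g (p + s *\<^sub>R axis 3 1) $ 3 \<partial>lborel))"
    unfolding J_def[abs_def] by (rule set_integral_add)
  fix n and l' u' :: "real^3" assume sub: "box l' u' \<subseteq> box l u"
  let ?\<phi> = "bump3 n l' u'"
  have [measurable]: "?\<phi> \<in> borel_measurable borel"
    by (intro borel_measurable_continuous_onI continuous_intros)
  obtain \<Psi> where \<Psi>: "test_fun \<Psi>"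
      "\<And>p. \<Psi> p = (\<integral>s. indicator {0..5} s * ?\<phi> (p - s *\<^sub>R ?e) \<partial>lborel)"
      "\<And>p. frechet_derivative \<Psi> (at p) ?e = ?\<phi> p - ?\<phi> (p - 5 *\<^sub>R ?e)"
    using bump3_vertical_primitive[of 5 n l' u'] by auto
  have "(\<integral>p. f p * frechet_derivative \<Psi> (at p) ?e \<partial>lborel) = - (\<integral>p. g p $ 3 * \<Psi> p \<partial>lborel)"
    using fg \<Psi>(1) by (simp add: H1_adm_def weak_grad_def)
  moreover have "f p * frechet_derivative \<Psi> (at p) ?e = f p * ?\<phi> p" for p
  proof (cases "p - 5 *\<^sub>R ?e \<in> box l' u'")
    case True
    then have "p - 5 *\<^sub>R ?e \<in> box l u" using sub by blast
    then have "l$3 < p$3 - 5" by (auto simp: mem_box_cart axis_def forall_3)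
    then have "1 < \<bar>p$3\<bar>" using l by simp
    then show ?thesis using fg by (simp add: H1_adm_def)
  qed (simp add: \<Psi>(3) bump3_eq_0)
  moreover have "(\<integral>p. g p $ 3 * \<Psi> p \<partial>lborel) = (\<integral>p. ?\<phi> p * J p \<partial>lborel)"
    unfolding \<Psi>(2) J_def
    by (rule integrable_vertical_average(2)[OF g, symmetric])
      (use bump3_le_indicator bump3_bounds in auto)
  ultimately have "(\<integral>p. f p * ?\<phi> p \<partial>lborel) + (\<integral>p. ?\<phi> p * J p \<partial>lborel) = 0"
    by (simp only:)
  moreover have "integrable lborel (\<lambda>p. ?\<phi> p * J p)"
    unfolding J_def
    by (rule integrable_vertical_average(1)[OF g])
      (use bump3_le_indicator bump3_bounds in auto)
  moreover have "integrable lborel (\<lambda>p. f p * ?\<phi> p)"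
  proof (rule Bochner_Integration.integrable_bound)
    show "integrable lborel (\<lambda>p. indicator (cbox l' u') p * f p)"
      by (rule L2loc_integrable[OF f]) (rule compact_cbox)
    show "AE p in lborel. norm (f p * ?\<phi> p) \<le> norm (indicator (cbox l' u') p * f p)"
    proof (rule AE_I2)
      fix p
      show "norm (f p * ?\<phi> p) \<le> norm (indicator (cbox l' u') p * f p)"
        using bump3_eq_0[of p l' u' n] bump3_bounds[of n l' u' p] box_subset_cbox[of l' u']
        by (cases "p \<in> box l' u'") (auto simp: abs_mult mult_left_le)
    qed
  qed measurable
  ultimately have "(\<integral>p. f p * ?\<phi> p + ?\<phi> p * J p \<partial>lborel) = 0"
    by simp
  then show "(\<integral>p. (f p + (\<integral>s. indicator {0..5} s * g (p + s *\<^sub>R axis 3 1) $ 3 \<partial>lborel)) * ?\<phi> p \<partial>lborel) = 0"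
    unfolding J_def by (simp only: distrib_right mult.commute[of "?\<phi> _"])
qed

lemma cell_eq_cbox: "cell a b = cbox (vector [0, 0, -1]) (vector [2*pi/a, 2*pi/b, 1])"
  by (auto simp: cell_def mem_box_cart forall_3)

lemma compact_cell: "compact (cell a b)"
  by (simp add: cell_eq_cbox compact_cbox)

lemma cell_borel [measurable]: "cell a b \<in> sets borel"
  by (simp add: cell_eq_cbox)

lemma norm_vec_square: "(norm (x :: real^'n))\<^sup>2 = (\<Sum>i\<in>UNIV. (x$i)\<^sup>2)"
  by (simp add: norm_vec_def L2_set_def sum_nonneg)

text \<open>The constant is 5 * 5: one factor from Cauchy-Schwarz on a segment of length 5, the
  other from integrating over the shift s in [0, 5]. Shifted cells leave the layer only upwards,
  where the vertical derivative vanishes.\<close>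

theorem poincare_H1_adm:
  assumes fg: "H1_adm a b f g"
  shows "(LINT p:cell a b|lborel. (f p)\<^sup>2) \<le> 25 * gn2 a b g"
proof -
  let ?e = "axis 3 1 :: real^3"
  define l :: "real^3" where "l = vector [-1, -1, -2]"
  define u :: "real^3" where "u = vector [2*pi/a + 1, 2*pi/b + 1, 2]"
  \<comment> \<open>The cell shifted up by at most 5 reaches height 6, so heights between 1 and 7,
    with a horizontal margin, contain everything that leaves it.\<close>
  define l2 :: "real^3" where "l2 = vector [-1, -1, 1]"
  define u2 :: "real^3" where "u2 = vector [2*pi/a + 1, 2*pi/b + 1, 7]"
  define J where "J p = (\<integral>s. indicator {0..5} s * g (p + s *\<^sub>R ?e) $ 3 \<partial>lborel)" for p
  let ?C = "indicator (cell a b) :: real^3 \<Rightarrow> ennreal"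
  let ?S = "indicator {0..5} :: real \<Rightarrow> ennreal"
  have f: "L2loc f" and g: "\<And>i. L2loc (\<lambda>p. g p $ i)" using fg by (auto simp: H1_adm_def)
  then have [measurable]: "f \<in> borel_measurable borel" "\<And>i. (\<lambda>p. g p $ i) \<in> borel_measurable borel"
    by (auto simp: L2loc_def)
  have fJ: "AE p in lborel. p \<in> box l u \<longrightarrow> f p + J p = 0"
    unfolding J_def by (rule H1_adm_eq_vertical_integral[OF fg]) (auto simp: l_def u_def)
  have g0: "AE p in lborel. p \<in> box l2 u2 \<longrightarrow> g p $ 3 = 0"
    by (rule H1_adm_gradient_zero_above[OF fg]) (auto simp: l2_def)
  have "(\<integral>\<^sup>+p. ?C p * ennreal ((f p)\<^sup>2) \<partial>lborel) \<le> (\<integral>\<^sup>+p. ?C p * ennreal ((J p)\<^sup>2) \<partial>lborel)"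
  proof (rule nn_integral_mono_AE)
    show "AE p in lborel. ?C p * ennreal ((f p)\<^sup>2) \<le> ?C p * ennreal ((J p)\<^sup>2)"
      using fJ
    proof eventually_elim
      case (elim p)
      have "cell a b \<subseteq> box l u"
        by (auto simp: cell_def l_def u_def mem_box_cart forall_3)
      with elim have "p \<in> cell a b \<Longrightarrow> f p = - J p" by (auto simp: add_eq_0_iff2)
      then show ?case by (auto simp: indicator_def)
    qed
  qed
  also have "\<dots> \<le> (\<integral>\<^sup>+p. ?C p * (ennreal 5 * (\<integral>\<^sup>+s. ?S s * ennreal ((g (p + s *\<^sub>R ?e) $ 3)\<^sup>2) \<partial>lborel)) \<partial>lborel)"
    unfolding J_def
    by (intro nn_integral_mono mult_left_mono ennreal_integral_square_le) auto
  \<comment> \<open>The seemingly redundant \<open>p + s *\<^sub>R ?e - s *\<^sub>R ?e\<close>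
    displays p as a function of the sheared point, in the form required by
    \<open>nn_integral_shear\<close>.\<close>
  also have "\<dots> = (\<integral>\<^sup>+p. \<integral>\<^sup>+s. 5 * (?S s * (?C (p + s *\<^sub>R ?e - s *\<^sub>R ?e) * ennreal ((g (p + s *\<^sub>R ?e) $ 3)\<^sup>2))) \<partial>lborel \<partial>lborel)"
    by (intro nn_integral_cong) (simp add: nn_integral_cmult[symmetric] mult_ac)
  also have "\<dots> = (\<integral>\<^sup>+s. \<integral>\<^sup>+p. 5 * (?S s * (?C (p - s *\<^sub>R ?e) * ennreal ((g p $ 3)\<^sup>2))) \<partial>lborel \<partial>lborel)"
    by (rule nn_integral_shear[where H="\<lambda>p s. 5 * (?S s * (?C (p - s *\<^sub>R ?e) * ennreal ((g p $ 3)\<^sup>2)))"]) measurable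
  also have "\<dots> \<le> (\<integral>\<^sup>+s. \<integral>\<^sup>+p. 5 * (?S s * (?C p * ennreal ((g p $ 3)\<^sup>2))) \<partial>lborel \<partial>lborel)"
  proof (rule nn_integral_mono, rule nn_integral_mono_AE)
    \<comment> \<open>A point p outside the cell with p - s e inside lies strictly above the wall z
      = 1; there the third component of g is 0 almost everywhere, so the shifted cell may be
      replaced by the cell.\<close>
    fix s :: real
    show "AE p in lborel. 5 * (?S s * (?C (p - s *\<^sub>R ?e) * ennreal ((g p $ 3)\<^sup>2)))
        \<le> 5 * (?S s * (?C p * ennreal ((g p $ 3)\<^sup>2)))"
      using g0
    proof eventually_elim
      case (elim p)
      show ?case
      proof (cases "0 \<le> s \<and> s \<le> 5 \<and> p - s *\<^sub>R ?e \<in> cell a b \<and> p \<notin> cell a b")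
        case True
        then have "p \<in> box l2 u2"
          by (auto simp: cell_def l2_def u2_def mem_box_cart forall_3 axis_def)
        then show ?thesis using elim by simp
      qed (auto simp: indicator_def)
    qed
  qed
  also have "\<dots> = (\<integral>\<^sup>+s. 5 * (?S s * (\<integral>\<^sup>+p. ?C p * ennreal ((g p $ 3)\<^sup>2) \<partial>lborel)) \<partial>lborel)"
    by (simp add: nn_integral_cmult)
  also have "\<dots> = 5 * (5 * (\<integral>\<^sup>+p. ?C p * ennreal ((g p $ 3)\<^sup>2) \<partial>lborel))"
    by (simp add: nn_integral_cmult nn_integral_multc)
  also have "\<dots> = 25 * (\<integral>\<^sup>+p. ?C p * ennreal ((g p $ 3)\<^sup>2) \<partial>lborel)"
    by (simp add: mult.assoc[symmetric])
  also have "\<dots> \<le> 25 * (\<integral>\<^sup>+p. ?C p * ennreal ((norm (g p))\<^sup>2) \<partial>lborel)"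
    using component_le_norm_cart[of "g _" 3]
    by (intro mult_left_mono nn_integral_mono ennreal_leI) (auto simp: abs_le_square_iff[symmetric])
  finally have le: "(\<integral>\<^sup>+p. ?C p * ennreal ((f p)\<^sup>2) \<partial>lborel)
      \<le> 25 * (\<integral>\<^sup>+p. ?C p * ennreal ((norm (g p))\<^sup>2) \<partial>lborel)" .
  have int_f: "integrable lborel (\<lambda>p. indicator (cell a b) p * (f p)\<^sup>2)"
    by (rule L2loc_integrable[OF f compact_cell])
  have int_g: "integrable lborel (\<lambda>p. indicator (cell a b) p * (norm (g p))\<^sup>2)"
    unfolding norm_vec_square sum_distrib_left
    by (intro Bochner_Integration.integrable_sum L2loc_integrable[OF g compact_cell])
  have nn: "(\<integral>\<^sup>+p. ?C p * ennreal (k p) \<partial>lborel) = ennreal (LINT p:cell a b|lborel. k p)"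
    if "integrable lborel (\<lambda>p. indicator (cell a b) p * k p)" "\<And>p. 0 \<le> k p" for k
  proof -
    have "(\<integral>\<^sup>+p. ?C p * ennreal (k p) \<partial>lborel) = (\<integral>\<^sup>+p. ennreal (indicator (cell a b) p * k p) \<partial>lborel)"
      by (intro nn_integral_cong) (auto simp: indicator_def)
    also have "\<dots> = ennreal (LINT p:cell a b|lborel. k p)"
      unfolding set_lebesgue_integral_def using that by (subst nn_integral_eq_integral) auto
    finally show ?thesis .
  qed
  have pos: "0 \<le> gn2 a b g"
    unfolding gn2_def set_lebesgue_integral_def by (intro Bochner_Integration.integral_nonneg) auto
  have "ennreal (LINT p:cell a b|lborel. (f p)\<^sup>2) \<le> 25 * ennreal (gn2 a b g)"
    using le unfolding gn2_def by (simp add: nn int_f int_g)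
  also have "\<dots> = ennreal (25 * gn2 a b g)"
    using pos by (simp add: ennreal_mult)
  finally show ?thesis
    using pos by simp
qed

section \<open>Integration by parts in the slab\<close>

lemma integrable_continuous_compact:
  fixes G :: "'a::euclidean_space \<Rightarrow> real"
  assumes "compact K" "continuous_on K G"
  shows "integrable lborel (\<lambda>p. indicator K p * G p)"
  using borel_integrable_compact[OF assms] by simp

text \<open>Integrating \<open>indicator K (p - s e) * indicator K p * G p\<close> with K the box over p and s in both orders, a shear turns one of them into slice integrals
  and the other into the side length times the full integral: no coordinatewise Fubini theorem is needed.\<close>

lemma integral_cbox_zero_if_slice_integrals_zero:
  fixes G :: "real^'n \<Rightarrow> real"
  assumes G: "continuous_on (cbox lo hi) G" and i: "lo$i < hi$i"
    and slice: "\<And>p. p \<in> cbox lo hi \<Longrightarrow> p$i = lo$i \<Longrightarrow>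
      (\<integral>s. indicator {0..hi$i - lo$i} s * G (p + s *\<^sub>R axis i 1) \<partial>lborel) = 0"
  shows "(LINT p:cbox lo hi|lborel. G p) = 0"
proof -
  let ?e = "axis i 1 :: real^'n"
  define T where "T = hi$i - lo$i"
  define K where "K = cbox lo hi"
  define G' where "G' p = indicator K p * G p" for p
  have G': "integrable lborel G'"
    unfolding G'_def[abs_def] K_def by (rule integrable_continuous_compact[OF compact_cbox G])
  then have [measurable]: "G' \<in> borel_measurable borel" by auto
  have [measurable]: "K \<in> sets borel" by (simp add: K_def)
  define H where "H p s = indicator K (p - s *\<^sub>R ?e) * G' p" for p s
  have line: "p + s *\<^sub>R ?e \<in> K \<longleftrightarrow> lo$i \<le> p$i + s \<and> p$i + s \<le> hi$i" if "p \<in> K" for p s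
    using that by (auto simp: K_def mem_box_cart axis_def split: if_splits)
  have H: "integrable (lborel \<Otimes>\<^sub>M lborel) (case_prod H)"
  proof (rule integrable_product_bound[OF G'])
    show "case_prod H \<in> borel_measurable (lborel \<Otimes>\<^sub>M lborel)"
      unfolding H_def by measurable
    show "\<bar>H p s\<bar> \<le> indicator {-T..T} s * \<bar>G' p\<bar>" for p s
    proof (cases "p \<in> K \<and> p - s *\<^sub>R ?e \<in> K")
      case True
      then have "s \<in> {-T..T}"
        using line[of p "-s"] line[of p 0] by (auto simp: T_def)
      then show ?thesis using True by (simp add: H_def)
    qed (auto simp: H_def G'_def indicator_def)
  qed
  have inner1: "(\<integral>s. H (p + s *\<^sub>R ?e) s \<partial>lborel) = 0" for p
  proof (cases "p \<in> K")
    case True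
    \<comment> \<open>q is the foot of the line through p on the lower face, the only place where
      the hypothesis on slices speaks.\<close>
    define q where "q = p - (p$i - lo$i) *\<^sub>R ?e"
    have q: "q \<in> K" "q$i = lo$i"
      using True line[OF True, of "lo$i - p$i"] line[OF True, of 0] i
      by (auto simp: q_def algebra_simps)
    have "(\<integral>s. H (p + s *\<^sub>R ?e) s \<partial>lborel) = (\<integral>s. G' (p + s *\<^sub>R ?e) \<partial>lborel)"
      using True by (simp add: H_def)
    also have "\<dots> = (\<integral>s. G' (q + ((p$i - lo$i) + 1 * s) *\<^sub>R ?e) \<partial>lborel)"
      by (simp add: q_def algebra_simps)
    also have "\<dots> = (\<integral>s. G' (q + s *\<^sub>R ?e) \<partial>lborel)"
      using lborel_integral_real_affine[of 1 "\<lambda>s. G' (q + s *\<^sub>R ?e)" "p$i - lo$i"] by simp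
    also have "\<dots> = (\<integral>s. indicator {0..hi$i - lo$i} s * G (q + s *\<^sub>R ?e) \<partial>lborel)"
      by (intro Bochner_Integration.integral_cong refl)
        (use line[OF q(1)] q(2) in \<open>auto simp: G'_def indicator_def\<close>)
    also have "\<dots> = 0" using slice q by (simp add: K_def)
    finally show ?thesis .
  qed (simp add: H_def)
  \<comment> \<open>Without the shear, the values of s with p - s e in \<open>K\<close> form an
    interval of length \<open>T\<close>, whatever p in \<open>K\<close> is.\<close>
  have inner2: "(\<integral>s. H p s \<partial>lborel) = T * G' p" for p
  proof (cases "p \<in> K")
    case True
    have "indicator K (p - s *\<^sub>R ?e) = (indicator {p$i - hi$i..p$i - lo$i} s :: real)" for s
      using line[OF True, of "-s"] by (auto simp: indicator_def)
    then show ?thesis using i by (simp add: H_def T_def)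
  qed (simp add: H_def G'_def)
  have "T * (\<integral>p. G' p \<partial>lborel) = 0"
    using integral_shear[OF H, of ?e] by (simp add: inner1 inner2)
  then show ?thesis
    using i by (simp add: T_def set_lebesgue_integral_def G'_def K_def)
qed

definition slab :: "(real^3) set" where
  "slab = {p. \<bar>p$3\<bar> \<le> 1}"

text \<open>Derivatives are taken along lines in the slab (one-sided on the walls), which keeps the calculus one-dimensional.\<close>
definition slice_deriv :: "3 \<Rightarrow> (real^3 \<Rightarrow> real) \<Rightarrow> (real^3 \<Rightarrow> real) \<Rightarrow> bool" where
  "slice_deriv i F G \<longleftrightarrow> continuous_on slab F \<and> continuous_on slab G \<and>
    (\<forall>p s. p + s *\<^sub>R axis i 1 \<in> slab \<longrightarrow>
      ((\<lambda>\<sigma>. F (p + \<sigma> *\<^sub>R axis i 1)) has_real_derivative G (p + s *\<^sub>R axis i 1))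
        (at s within {\<sigma>. p + \<sigma> *\<^sub>R axis i 1 \<in> slab}))"

lemma slice_deriv_mult:
  "slice_deriv i F F' \<Longrightarrow> slice_deriv i G G' \<Longrightarrow>
    slice_deriv i (\<lambda>p. F p * G p) (\<lambda>p. F' p * G p + F p * G' p)"
  unfolding slice_deriv_def
  by (auto intro!: continuous_intros DERIV_mult[THEN DERIV_cong])

lemma slice_deriv_profile:
  assumes "continuous_on {-1..1} U" "i \<noteq> 3"
  shows "slice_deriv i (\<lambda>p. U (p$3)) (\<lambda>p. 0)"
proof -
  have "continuous_on slab (\<lambda>p. U (p$3))"
    by (rule continuous_on_compose2[OF assms(1)])
      (auto simp: slab_def abs_le_iff intro!: continuous_intros)
  then show ?thesis
    using assms(2) by (auto simp: slice_deriv_def axis_def)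
qed

text \<open>The fundamental theorem of calculus on each segment. Equality on opposite faces is the
  common form of periodicity, vanishing on the walls, and compact support.\<close>

lemma slice_deriv_integral_zero:
  assumes FG: "slice_deriv i F G" and sub: "cbox lo hi \<subseteq> slab" and i: "lo$i < hi$i"
    and face: "\<And>p. p \<in> cbox lo hi \<Longrightarrow> p$i = lo$i \<Longrightarrow> F (p + (hi$i - lo$i) *\<^sub>R axis i 1) = F p"
  shows "(LINT p:cbox lo hi|lborel. G p) = 0"
proof (rule integral_cbox_zero_if_slice_integrals_zero[OF _ i])
  show G: "continuous_on (cbox lo hi) G"
    using FG sub by (auto simp: slice_deriv_def intro: continuous_on_subset)
  fix p assume p: "p \<in> cbox lo hi" "p$i = lo$i"
  let ?e = "axis i 1 :: real^3" and ?T = "hi$i - lo$i"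
  have seg: "p + s *\<^sub>R ?e \<in> cbox lo hi" if "s \<in> {0..?T}" for s
    using that p by (auto simp: mem_box_cart axis_def)
  have "(\<integral>s. indicator {0..?T} s *\<^sub>R G (p + s *\<^sub>R ?e) \<partial>lborel) = F (p + ?T *\<^sub>R ?e) - F (p + 0 *\<^sub>R ?e)"
  proof (rule integral_FTC_atLeastAtMost)
    show "continuous_on {0..?T} (\<lambda>s. G (p + s *\<^sub>R ?e))"
      by (rule continuous_on_compose2[OF G]) (use seg in \<open>auto intro!: continuous_intros\<close>)
    fix s assume s: "0 \<le> s" "s \<le> ?T"
    have "((\<lambda>s. F (p + s *\<^sub>R ?e)) has_real_derivative G (p + s *\<^sub>R ?e)) (at s within {\<sigma>. p + \<sigma> *\<^sub>R ?e \<in> slab})"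
      using FG s seg[of s] sub by (auto simp: slice_deriv_def)
    then have "((\<lambda>s. F (p + s *\<^sub>R ?e)) has_real_derivative G (p + s *\<^sub>R ?e)) (at s within {0..?T})"
      by (rule DERIV_subset) (use seg sub in auto)
    then show "((\<lambda>s. F (p + s *\<^sub>R ?e)) has_vector_derivative G (p + s *\<^sub>R ?e)) (at s within {0..?T})"
      by (simp add: has_real_derivative_iff_has_vector_derivative)
  qed (use i in simp)
  then show "(\<integral>s. indicator {0..?T} s * G (p + s *\<^sub>R ?e) \<partial>lborel) = 0"
    using face[OF p] by simp
qed

lemma test_fun_slice_deriv:
  assumes "test_fun \<phi>"
  shows "slice_deriv i \<phi> (\<lambda>p. frechet_derivative \<phi> (at p) (axis i 1))"
proof -
  have "Ck 0 \<phi>" "Ck 1 \<phi>" using assms unfolding test_fun_def by blast+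
  then have cont: "continuous_on UNIV \<phi>" "continuous_on UNIV (\<lambda>p. frechet_derivative \<phi> (at p) (axis i 1))"
    and diff: "\<And>p. \<phi> differentiable (at p)" by auto
  have "((\<lambda>\<sigma>. \<phi> (p + \<sigma> *\<^sub>R axis i 1)) has_real_derivative
      frechet_derivative \<phi> (at (p + s *\<^sub>R axis i 1)) (axis i 1)) (at s within S)" for p s S
  proof -
    let ?D = "frechet_derivative \<phi> (at (p + s *\<^sub>R axis i 1))"
    have D: "(\<phi> has_derivative ?D) (at (p + s *\<^sub>R axis i 1))"
      using diff frechet_derivative_works by blast
    have "((\<lambda>\<sigma>. p + \<sigma> *\<^sub>R axis i 1) has_derivative (\<lambda>\<sigma>. \<sigma> *\<^sub>R axis i 1)) (at s within S)"
      by (auto intro!: derivative_eq_intros)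
    from has_derivative_compose[OF this D]
    show ?thesis
      unfolding has_field_derivative_def
      by (simp add: linear_scale[OF has_derivative_linear[OF D]] mult.commute[of _ "?D (axis i 1)"])
  qed
  then show ?thesis
    unfolding slice_deriv_def using cont by (auto intro: continuous_on_subset)
qed

text \<open>Classical fields have unspecified values off the slab, while the variational class
  prescribes 0 there. The polymorphic value type serves scalars, vectors and Jacobians
  alike.\<close>

definition zero_ext :: "(real^3 \<Rightarrow> 'b::zero) \<Rightarrow> real^3 \<Rightarrow> 'b" where
  "zero_ext f p = (if p \<in> slab then f p else 0)"

lemma closed_slab: "closed slab"
proof -
  have eq: "slab = {p. p$3 \<le> 1} \<inter> {p. -1 \<le> p$3}" by (auto simp: slab_def abs_le_iff)
  show ?thesis
    unfolding eq by (intro closed_Int closed_Collect_le continuous_intros)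
qed

lemma L2loc_zero_ext:
  assumes f: "continuous_on slab f"
  shows "L2loc (zero_ext f)"
  unfolding L2loc_def
proof (intro conjI allI impI)
  have eq: "zero_ext f = (\<lambda>p. indicator slab p *\<^sub>R f p)"
    by (auto simp: zero_ext_def indicator_def)
  show "zero_ext f \<in> borel_measurable lborel"
    unfolding eq using borel_measurable_continuous_on_indicator[OF _ f] closed_slab by simp
  fix K :: "(real^3) set" assume K: "compact K"
  have "compact (K \<inter> slab)" using K closed_slab by (rule compact_Int_closed)
  then have "integrable lborel (\<lambda>p. indicator (K \<inter> slab) p * (f p)\<^sup>2)"
    by (rule integrable_continuous_compact)
      (use continuous_on_subset[OF f] in \<open>auto intro!: continuous_intros\<close>)
  moreover have "indicator (K \<inter> slab) p * (f p)\<^sup>2 = indicator K p *\<^sub>R (zero_ext f p)\<^sup>2" for p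
    by (auto simp: zero_ext_def indicator_def)
  ultimately show "set_integrable lborel K (\<lambda>p. (zero_ext f p)\<^sup>2)"
    unfolding set_integrable_def by simp
qed

text \<open>The gradient may jump across the walls, but f itself does not: integrating by parts on a
  box from wall to wall, wide enough for the support of the test function, leaves no boundary
  term.\<close>

lemma weak_grad_zero_ext:
  assumes fg: "\<And>i. slice_deriv i f (\<lambda>p. g p $ i)" and wall: "\<And>p. \<bar>p$3\<bar> = 1 \<Longrightarrow> f p = 0"
  shows "weak_grad (zero_ext f) (zero_ext g)"
  unfolding weak_grad_def
proof (intro allI impI)
  fix \<phi> :: "real^3 \<Rightarrow> real" and i assume \<phi>: "test_fun \<phi>"
  let ?d\<phi> = "\<lambda>p. frechet_derivative \<phi> (at p) (axis i 1)"
  have "bounded (closure {p. \<phi> p \<noteq> 0})"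
    using \<phi> by (auto simp: test_fun_def compact_imp_bounded)
  then obtain N where N: "\<And>p. p \<in> closure {p. \<phi> p \<noteq> 0} \<Longrightarrow> norm p \<le> N"
    by (auto simp: bounded_iff)
  \<comment> \<open>The margin 1 puts every point with a coordinate of size at least
    \<open>M\<close> outside the closed support, and makes the box nondegenerate.\<close>
  define M where "M = \<bar>N\<bar> + 1"
  have zero: "\<phi> p = 0" if "p \<in> - closure {p. \<phi> p \<noteq> 0}" for p
    using that closure_subset[of "{p. \<phi> p \<noteq> 0}"] by blast
  have M: "\<phi> p = 0" "?d\<phi> p = 0" if "M \<le> \<bar>p$j\<bar>" for p j
  proof -
    have out: "p \<in> - closure {p. \<phi> p \<noteq> 0}"
      using N[of p] component_le_norm_cart[of p j] that by (auto simp: M_def)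
    then show "\<phi> p = 0" by (rule zero)
    \<comment> \<open>The complement of the closed support is open, so the derivative vanishes there
      together with \<phi>.\<close>
    have "(\<phi> has_derivative (\<lambda>v. 0)) (at p)"
    proof (rule has_derivative_transform_within_open[where s="- closure {p. \<phi> p \<noteq> 0}"])
      show "((\<lambda>p. 0) has_derivative (\<lambda>v. 0)) (at p)" by simp
      show "open (- closure {p. \<phi> p \<noteq> 0})" by (rule open_Compl[OF closed_closure])
      show "0 = \<phi> x" if "x \<in> - closure {p. \<phi> p \<noteq> 0}" for x using zero[OF that] by simp
    qed (rule out)
    from frechet_derivative_at[OF this, symmetric] show "?d\<phi> p = 0" by simp
  qed
  define lo :: "real^3" where "lo = vector [-M, -M, -1]"
  define hi :: "real^3" where "hi = vector [M, M, 1]"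
  have M1: "1 \<le> M" by (simp add: M_def)
  have box: "p \<in> cbox lo hi \<longleftrightarrow> \<bar>p$1\<bar> \<le> M \<and> \<bar>p$2\<bar> \<le> M \<and> \<bar>p$3\<bar> \<le> 1" for p
    by (auto simp: lo_def hi_def mem_box_cart forall_3 abs_le_iff)
  then have sub: "cbox lo hi \<subseteq> slab" by (auto simp: slab_def)
  have prod: "slice_deriv i (\<lambda>p. f p * \<phi> p) (\<lambda>p. g p $ i * \<phi> p + f p * ?d\<phi> p)"
    by (rule slice_deriv_mult[OF fg test_fun_slice_deriv[OF \<phi>]])
  \<comment> \<open>For i = 3 the wall condition on f makes the product vanish, for i = 1, 2 the
    support of \<phi>.\<close>
  have face: "f p * \<phi> p = 0" if "p$i = lo$i \<or> p$i = hi$i" for p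
    using that exhaust_3[of i] M(1)[of p i] wall[of p] M1 by (auto simp: lo_def hi_def)
  have "(LINT p:cbox lo hi|lborel. g p $ i * \<phi> p + f p * ?d\<phi> p) = 0"
  proof (rule slice_deriv_integral_zero[OF prod sub])
    show "lo$i < hi$i"
      using exhaust_3[of i] M1 by (auto simp: lo_def hi_def)
    show "f (p + (hi$i - lo$i) *\<^sub>R axis i 1) * \<phi> (p + (hi$i - lo$i) *\<^sub>R axis i 1) = f p * \<phi> p"
      if "p$i = lo$i" for p
    proof -
      have "(p + (hi$i - lo$i) *\<^sub>R axis i 1) $ i = hi$i"
        using that by (simp add: axis_def)
      then show ?thesis
        using that face[of p] face[of "p + (hi$i - lo$i) *\<^sub>R axis i 1"] by metis
    qed
  qed
  moreover have c: "continuous_on (cbox lo hi) (\<lambda>p. g p $ i)" "continuous_on (cbox lo hi) \<phi>"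
      "continuous_on (cbox lo hi) f" "continuous_on (cbox lo hi) ?d\<phi>"
    using fg[of i] test_fun_slice_deriv[OF \<phi>, of i] sub
    by (auto simp: slice_deriv_def intro: continuous_on_subset)
  have "integrable lborel (\<lambda>p. indicator (cbox lo hi) p * (g p $ i * \<phi> p))"
    "integrable lborel (\<lambda>p. indicator (cbox lo hi) p * (f p * ?d\<phi> p))"
    by (intro integrable_continuous_compact compact_cbox continuous_intros c)+
  ultimately have "(\<integral>p. indicator (cbox lo hi) p * (g p $ i * \<phi> p) \<partial>lborel)
      + (\<integral>p. indicator (cbox lo hi) p * (f p * ?d\<phi> p) \<partial>lborel) = 0"
    by (simp add: set_lebesgue_integral_def distrib_left)
  moreover have "indicator (cbox lo hi) p * (g p $ i * \<phi> p) = zero_ext g p $ i * \<phi> p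
      \<and> indicator (cbox lo hi) p * (f p * ?d\<phi> p) = zero_ext f p * ?d\<phi> p" for p
  proof (cases "p \<in> cbox lo hi")
    case True
    then show ?thesis using sub by (auto simp: zero_ext_def)
  next
    case False
    then consider "p \<notin> slab" | "M \<le> \<bar>p$1\<bar>" | "M \<le> \<bar>p$2\<bar>"
      by (fastforce simp: box slab_def)
    then show ?thesis
      by cases (use M False in \<open>auto simp: zero_ext_def\<close>)
  qed
  ultimately show "(\<integral>p. zero_ext f p * ?d\<phi> p \<partial>lborel) = - (\<integral>p. zero_ext g p $ i * \<phi> p \<partial>lborel)"
    by (simp only:)
qed

lemma H1_adm_zero_ext:
  assumes fg: "\<And>i. slice_deriv i f (\<lambda>p. g p $ i)" and wall: "\<And>p. \<bar>p$3\<bar> = 1 \<Longrightarrow> f p = 0"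
    and per: "\<And>p. p \<in> slab \<Longrightarrow> f (p + axis 1 (2*pi/a)) = f p"
      "\<And>p. p \<in> slab \<Longrightarrow> f (p + axis 2 (2*pi/b)) = f p"
  shows "H1_adm a b (zero_ext f) (zero_ext g)"
  unfolding H1_adm_def
proof (intro conjI allI impI)
  show "L2loc (zero_ext f)"
    using fg[of 1] by (intro L2loc_zero_ext) (simp add: slice_deriv_def)
  show "L2loc (\<lambda>p. zero_ext g p $ i)" for i
  proof -
    have "zero_ext (\<lambda>p. g p $ i) = (\<lambda>p. zero_ext g p $ i)"
      by (auto simp: zero_ext_def)
    then show ?thesis
      using L2loc_zero_ext[of "\<lambda>p. g p $ i"] fg[of i] by (simp add: slice_deriv_def)
  qed
  show "weak_grad (zero_ext f) (zero_ext g)"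
    by (rule weak_grad_zero_ext[OF fg wall])
  show "AE p in lborel. zero_ext f (p + axis 1 (2*pi/a)) = zero_ext f p"
    "AE p in lborel. zero_ext f (p + axis 2 (2*pi/b)) = zero_ext f p"
    using per by (auto intro!: AE_I2 simp: zero_ext_def slab_def axis_def)
qed (simp add: zero_ext_def slab_def)

section \<open>Boundedness of the energy quotient\<close>

lemma set_integral_L2loc_product_bound:
  assumes f: "L2loc f" and g: "L2loc g" and c: "continuous_on UNIV c"
    and M: "\<And>z. z \<in> {-1..1} \<Longrightarrow> \<bar>c z\<bar> \<le> M"
  shows "\<bar>LINT p:cell a b|lborel. c (p$3) * f p * g p\<bar>
    \<le> M * ((LINT p:cell a b|lborel. (f p)\<^sup>2) + (LINT p:cell a b|lborel. (g p)\<^sup>2))"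
proof -
  let ?C = "indicator (cell a b) :: real^3 \<Rightarrow> real"
  have [measurable]: "f \<in> borel_measurable borel" "g \<in> borel_measurable borel"
    using f g by (auto simp: L2loc_def)
  have M0: "0 \<le> M" using M[of 0] by (simp add: abs_le_iff)
  have [measurable]: "(\<lambda>p::real^3. c (p$3)) \<in> borel_measurable borel"
    by (intro borel_measurable_continuous_onI continuous_on_compose2[OF c] continuous_intros) auto
  have int: "integrable lborel (\<lambda>p. ?C p * (f p)\<^sup>2)" "integrable lborel (\<lambda>p. ?C p * (g p)\<^sup>2)"
    by (intro L2loc_integrable f g compact_cell)+
  then have int': "integrable lborel (\<lambda>p. M * (?C p * (f p)\<^sup>2 + ?C p * (g p)\<^sup>2))" by simp
  have bound: "\<bar>?C p * (c (p$3) * f p * g p)\<bar> \<le> M * (?C p * (f p)\<^sup>2 + ?C p * (g p)\<^sup>2)" for p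
  proof (cases "p \<in> cell a b")
    case True
    then have "\<bar>c (p$3)\<bar> \<le> M" by (intro M) (auto simp: cell_def)
    \<comment> \<open>The constant 1/2 is given away: only the finiteness of the supremum is at
      stake.\<close>
    moreover have "\<bar>f p * g p\<bar> \<le> (f p)\<^sup>2 + (g p)\<^sup>2"
      using sum_squares_bound[of "\<bar>f p\<bar>" "\<bar>g p\<bar>"] zero_le_power2[of "f p"] zero_le_power2[of "g p"]
      unfolding abs_mult power2_abs by linarith
    ultimately have "\<bar>c (p$3)\<bar> * \<bar>f p * g p\<bar> \<le> M * ((f p)\<^sup>2 + (g p)\<^sup>2)"
      by (intro mult_mono) (use M0 in auto)
    then show ?thesis using True by (simp add: abs_mult mult.assoc)
  qed simp
  have "\<bar>\<integral>p. ?C p * (c (p$3) * f p * g p) \<partial>lborel\<bar> \<le> (\<integral>p. \<bar>?C p * (c (p$3) * f p * g p)\<bar> \<partial>lborel)"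
    by (rule integral_abs_bound)
  also have "\<dots> \<le> (\<integral>p. M * (?C p * (f p)\<^sup>2 + ?C p * (g p)\<^sup>2) \<partial>lborel)"
    using bound by (intro integral_mono' int') (auto intro: order_trans[OF abs_ge_zero])
  finally show ?thesis
    using int by (simp add: set_lebesgue_integral_def)
qed

lemma gn2_nonneg: "0 \<le> gn2 a b g"
  unfolding gn2_def set_lebesgue_integral_def by (intro Bochner_Integration.integral_nonneg) auto

lemma D1form_nonneg: "0 \<le> D1form a b Ha Du Dh"
  unfolding D1form_def by (intro add_nonneg_nonneg mult_nonneg_nonneg gn2_nonneg) auto

text \<open>Each of the four pairings is controlled by squared norms of first and third components,
  hence by Poincare through gradients occurring in D1. The constant precedes the fields, so it
  bounds the whole set of quotients.\<close>

lemma Iform_bound: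
  assumes U': "continuous_on UNIV (deriv U)" and B': "continuous_on UNIV (deriv Bb)"
    and A: "0 \<le> A" and Ha: "0 < Ha"
  obtains C where "0 \<le> C" "\<And>u h :: real^3 \<Rightarrow> real^3. \<And>Du Dh :: real^3 \<Rightarrow> real^3^3.
    (\<And>j. H1_adm a b (\<lambda>p. u p $ j) (\<lambda>p. Du p $ j)) \<Longrightarrow> (\<And>j. H1_adm a b (\<lambda>p. h p $ j) (\<lambda>p. Dh p $ j)) \<Longrightarrow>
    \<bar>Iform a b A U Bb u h\<bar> \<le> C * D1form a b Ha Du Dh"
proof -
  have bnd: "\<exists>M. \<forall>z\<in>{-1..1}. \<bar>c z\<bar> \<le> M" if "continuous_on UNIV c" for c :: "real \<Rightarrow> real"
  proof -
    have "bounded (c ` {-1..1})"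
      by (intro compact_imp_bounded compact_continuous_image continuous_on_subset[OF that]) auto
    then show ?thesis by (auto simp: bounded_iff)
  qed
  obtain M1 M2 where M12: "\<And>z. z \<in> {-1..1} \<Longrightarrow> \<bar>deriv U z\<bar> \<le> M1" "\<And>z. z \<in> {-1..1} \<Longrightarrow> \<bar>deriv Bb z\<bar> \<le> M2"
    using bnd[OF U'] bnd[OF B'] by blast
  define M where "M = max M1 M2"
  have M: "\<And>z. z \<in> {-1..1} \<Longrightarrow> \<bar>deriv U z\<bar> \<le> M" "\<And>z. z \<in> {-1..1} \<Longrightarrow> \<bar>deriv Bb z\<bar> \<le> M"
    using M12 by (fastforce simp: M_def)+
  have M0: "0 \<le> M" using M(1)[of 0] by (simp add: abs_le_iff)
  \<comment> \<open>25 comes from Poincare and \<open>M\<close> bounds both profile slopes. After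
    collecting terms u carries 1 + A and h carries 2 A, the latter divided by the weight
    \<open>Ha\<^sup>2\<close> of D1; the two are added instead of taking their maximum.\<close>
  define C where "C = 25 * M * (1 + A + 2 * A / Ha\<^sup>2)"
  show thesis
  proof
    show "0 \<le> C" using M0 A by (simp add: C_def)
    fix u h :: "real^3 \<Rightarrow> real^3" and Du Dh :: "real^3 \<Rightarrow> real^3^3"
    assume u: "\<And>j. H1_adm a b (\<lambda>p. u p $ j) (\<lambda>p. Du p $ j)"
      and h: "\<And>j. H1_adm a b (\<lambda>p. h p $ j) (\<lambda>p. Dh p $ j)"
    define nu where "nu j = (LINT p:cell a b|lborel. (u p $ j)\<^sup>2)" for j
    define nh where "nh j = (LINT p:cell a b|lborel. (h p $ j)\<^sup>2)" for j
    define gu where "gu j = gn2 a b (\<lambda>p. Du p $ j)" for j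
    define gh where "gh j = gn2 a b (\<lambda>p. Dh p $ j)" for j
    have L2: "L2loc (\<lambda>p. u p $ j)" "L2loc (\<lambda>p. h p $ j)" for j
      using u h by (auto simp: H1_adm_def)
    have P: "nu j \<le> 25 * gu j" "nh j \<le> 25 * gh j" for j
      using poincare_H1_adm[OF u] poincare_H1_adm[OF h] by (auto simp: nu_def nh_def gu_def gh_def)
    have g0: "0 \<le> gu j" "0 \<le> gh j" for j by (auto simp: gu_def gh_def gn2_nonneg)
    have "\<bar>ip a b (\<lambda>p. deriv U (p$3) * u p $ 3) (\<lambda>p. u p $ 1)\<bar> \<le> M * (nu 3 + nu 1)"
      using set_integral_L2loc_product_bound[OF L2(1)[of 3] L2(1)[of 1] U' M(1)] by (simp add: ip_def nu_def)
    moreover have "\<bar>ip a b (\<lambda>p. h p $ 3 * deriv Bb (p$3)) (\<lambda>p. u p $ 1)\<bar> \<le> M * (nh 3 + nu 1)"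
      using set_integral_L2loc_product_bound[OF L2(2)[of 3] L2(1)[of 1] B' M(2)]
      by (simp add: ip_def nu_def nh_def mult.commute[of "deriv Bb _"])
    moreover have "\<bar>ip a b (\<lambda>p. u p $ 3 * deriv Bb (p$3)) (\<lambda>p. h p $ 1)\<bar> \<le> M * (nu 3 + nh 1)"
      using set_integral_L2loc_product_bound[OF L2(1)[of 3] L2(2)[of 1] B' M(2)]
      by (simp add: ip_def nu_def nh_def mult.commute[of "deriv Bb _"])
    moreover have "\<bar>ip a b (\<lambda>p. h p $ 3 * deriv U (p$3)) (\<lambda>p. h p $ 1)\<bar> \<le> M * (nh 3 + nh 1)"
      using set_integral_L2loc_product_bound[OF L2(2)[of 3] L2(2)[of 1] U' M(1)]
      by (simp add: ip_def nu_def nh_def mult.commute[of "deriv U _"])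
    ultimately have "\<bar>Iform a b A U Bb u h\<bar>
        \<le> M * (nu 3 + nu 1) + A * (M * (nh 3 + nu 1) + M * (nu 3 + nh 1) + M * (nh 3 + nh 1))"
      unfolding Iform_def
      by (intro order_trans[OF abs_triangle_ineq] add_mono)
        (simp_all add: abs_mult A mult_left_mono)
    also have "\<dots> = M * ((1 + A) * (nu 1 + nu 3) + 2 * A * (nh 1 + nh 3))"
      by (simp add: algebra_simps)
    also have "\<dots> \<le> M * ((1 + A) * (25 * gu 1 + 25 * gu 3) + 2 * A * (25 * gh 1 + 25 * gh 3))"
      by (intro mult_left_mono add_mono P M0) (use A in auto)
    also have "\<dots> \<le> C * (gu 1 + gu 3 + Ha\<^sup>2 * (gh 1 + gh 3))"
    proof -
      have "C * (gu 1 + gu 3 + Ha\<^sup>2 * (gh 1 + gh 3))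
          - M * ((1 + A) * (25 * gu 1 + 25 * gu 3) + 2 * A * (25 * gh 1 + 25 * gh 3))
          = 25 * M * (2 * A / Ha\<^sup>2 * (gu 1 + gu 3) + (1 + A) * Ha\<^sup>2 * (gh 1 + gh 3))"
        using Ha by (simp add: C_def field_simps)
      moreover have "0 \<le> \<dots>"
        using M0 A g0 by (intro mult_nonneg_nonneg add_nonneg_nonneg) auto
      ultimately show ?thesis by linarith
    qed
    finally show "\<bar>Iform a b A U Bb u h\<bar> \<le> C * D1form a b Ha Du Dh"
      by (simp add: D1form_def gu_def gh_def)
  qed
qed

section \<open>The energy identity\<close>

definition cell_periodic :: "real \<Rightarrow> real \<Rightarrow> (real^3 \<Rightarrow> real) \<Rightarrow> bool" where
  "cell_periodic a b F \<longleftrightarrow> (\<forall>p\<in>slab. F (p + axis 1 (2*pi/a)) = F p \<and> F (p + axis 2 (2*pi/b)) = F p)"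

definition wall_zero :: "(real^3 \<Rightarrow> real) \<Rightarrow> bool" where
  "wall_zero F \<longleftrightarrow> (\<forall>p. \<bar>p$3\<bar> = 1 \<longrightarrow> F p = 0)"

text \<open>Continuity is bundled in so that such functions can be added and scaled freely:
  additivity of the integral requires integrability.\<close>

definition cell_null :: "real \<Rightarrow> real \<Rightarrow> (real^3 \<Rightarrow> real) \<Rightarrow> bool" where
  "cell_null a b G \<longleftrightarrow> continuous_on slab G \<and> (LINT p:cell a b|lborel. G p) = 0"

context
  fixes a b :: real
  assumes a: "a > 0" and b: "b > 0"
begin

lemma cell_subset_slab: "cell a b \<subseteq> slab"
  by (auto simp: cell_def slab_def abs_le_iff)

lemma cell_integrable:
  "continuous_on slab (G :: _ \<Rightarrow> real) \<Longrightarrow> set_integrable lborel (cell a b) G"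
  using integrable_continuous_compact[OF compact_cell continuous_on_subset[OF _ cell_subset_slab], of G]
  by (simp add: set_integrable_def)

text \<open>One coordinate of the divergence theorem: for i = 1, 2 opposite faces cancel by
  periodicity, for i = 3 both face terms are zero.\<close>

lemma cell_null_slice_deriv:
  assumes FG: "slice_deriv i F G" and per: "cell_periodic a b F" and wall: "i = 3 \<Longrightarrow> wall_zero F"
  shows "cell_null a b G"
proof -
  let ?lo = "vector [0, 0, -1] :: real^3" and ?hi = "vector [2*pi/a, 2*pi/b, 1] :: real^3"
  have "(LINT p:cbox ?lo ?hi|lborel. G p) = 0"
  proof (rule slice_deriv_integral_zero[OF FG])
    show "cbox ?lo ?hi \<subseteq> slab" using cell_subset_slab by (simp add: cell_eq_cbox)
    show "?lo$i < ?hi$i" using exhaust_3[of i] a b by auto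
    fix p :: "real^3" assume p: "p \<in> cbox ?lo ?hi" "p$i = ?lo$i"
    then have ps: "p \<in> slab" using cell_subset_slab by (auto simp: cell_eq_cbox)
    consider "i = 1" | "i = 2" | "i = 3" using exhaust_3[of i] by blast
    then show "F (p + (?hi$i - ?lo$i) *\<^sub>R axis i 1) = F p"
    proof cases
      case 1
      have "(?hi$1 - ?lo$1) *\<^sub>R axis 1 1 = (axis 1 (2*pi/a) :: real^3)"
        by (simp add: vec_eq_iff axis_def)
      then show ?thesis using per ps 1 by (simp add: cell_periodic_def)
    next
      case 2
      have "(?hi$2 - ?lo$2) *\<^sub>R axis 2 1 = (axis 2 (2*pi/b) :: real^3)"
        by (simp add: vec_eq_iff axis_def)
      then show ?thesis using per ps 2 by (simp add: cell_periodic_def)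
    next
      case 3
      have "F p = 0" "F (p + (?hi$i - ?lo$i) *\<^sub>R axis i 1) = 0"
        using wall[OF 3] p 3 by (auto simp: wall_zero_def axis_def)
      then show ?thesis by simp
    qed
  qed
  then show ?thesis
    using FG by (simp add: cell_null_def slice_deriv_def cell_eq_cbox)
qed

lemma cell_null_cong:
  assumes "cell_null a b F" "\<And>p. p \<in> slab \<Longrightarrow> F p = G p"
  shows "cell_null a b G"
proof -
  have "continuous_on slab G"
    using assms by (simp add: cell_null_def cong: continuous_on_cong)
  moreover have "(LINT p:cell a b|lborel. F p) = (LINT p:cell a b|lborel. G p)"
    using assms(2) cell_subset_slab by (intro set_lebesgue_integral_cong) auto
  ultimately show ?thesis using assms(1) by (simp add: cell_null_def)
qed

lemma cell_null_add: "cell_null a b F \<Longrightarrow> cell_null a b G \<Longrightarrow> cell_null a b (\<lambda>p. F p + G p)"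
  unfolding cell_null_def by (auto intro!: continuous_intros simp: set_integral_add cell_integrable)

lemma cell_null_cmult: "cell_null a b F \<Longrightarrow> cell_null a b (\<lambda>p. c * F p)"
  unfolding cell_null_def by (auto intro!: continuous_intros)

lemma cell_null_diff: "cell_null a b F \<Longrightarrow> cell_null a b G \<Longrightarrow> cell_null a b (\<lambda>p. F p - G p)"
  using cell_null_add[of F "\<lambda>p. (-1) * G p"] cell_null_cmult[of G "-1"] by simp

lemma cell_null_sum:
  assumes "\<And>j. j \<in> S \<Longrightarrow> cell_null a b (F j)"
  shows "cell_null a b (\<lambda>p. \<Sum>j\<in>S. F j p)"
  using assms
proof (induction S rule: infinite_finite_induct)
  case (insert x S)
  then show ?case by (auto intro: cell_null_add)
qed (auto simp: cell_null_def set_lebesgue_integral_def)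

lemma cell_periodic_mult: "cell_periodic a b F \<Longrightarrow> cell_periodic a b G \<Longrightarrow> cell_periodic a b (\<lambda>p. F p * G p)"
  by (auto simp: cell_periodic_def)

lemma cell_periodic_profile: "cell_periodic a b (\<lambda>p. c (p$3))"
  by (auto simp: cell_periodic_def axis_def)

lemma wall_zero_mult: "wall_zero F \<Longrightarrow> wall_zero (\<lambda>p. F p * G p)"
  by (auto simp: wall_zero_def)

lemmas null_intros = slice_deriv_mult cell_periodic_mult cell_periodic_profile wall_zero_mult

text \<open>A profile in z passes through the x-derivative. With g = f this removes transport by U;
  with f and g from h and u it removes the coupling through the field \<open>Bb\<close>.\<close>

lemma cell_null_transport:
  assumes f: "slice_deriv 1 f f'" "cell_periodic a b f" and g: "slice_deriv 1 g g'" "cell_periodic a b g"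
    and U: "continuous_on {-1..1} U"
  shows "cell_null a b (\<lambda>p. U (p$3) * (f' p * g p + f p * g' p))"
proof -
  have "cell_null a b (\<lambda>p. 0 * (f p * g p) + U (p$3) * (f' p * g p + f p * g' p))"
    by (rule cell_null_slice_deriv[where F="\<lambda>p. U (p$3) * (f p * g p)" and i=1])
      (intro slice_deriv_mult slice_deriv_profile U f g
        cell_periodic_mult[OF cell_periodic_profile cell_periodic_mult] | simp)+
  then show ?thesis by simp
qed

text \<open>Accounts for the coupling of u and h through the constant vertical component of the
  basic magnetic field.\<close>

lemma cell_null_vertical:
  assumes f: "slice_deriv 3 f f'" "cell_periodic a b f" "wall_zero f" and g: "slice_deriv 3 g g'" "cell_periodic a b g"
  shows "cell_null a b (\<lambda>p. f' p * g p + f p * g' p)"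
  by (rule cell_null_slice_deriv[where F="\<lambda>p. f p * g p" and i=3]) (intro null_intros f g)+

text \<open>For divergence-free v, v . grad f is the divergence of f v. Used with products of
  components as f for the nonlinear terms, and with the pressure.\<close>

lemma cell_null_divergence_free:
  fixes v :: "3 \<Rightarrow> real^3 \<Rightarrow> real"
  assumes v: "\<And>i. slice_deriv i (v i) (v' i)" "\<And>i. cell_periodic a b (v i)" "\<And>i. wall_zero (v i)"
    and div: "\<And>p. p \<in> slab \<Longrightarrow> (\<Sum>i\<in>UNIV. v' i p) = 0"
    and f: "\<And>i. slice_deriv i f (f' i)" "cell_periodic a b f"
  shows "cell_null a b (\<lambda>p. \<Sum>i\<in>UNIV. v i p * f' i p)"
proof -
  have "cell_null a b (\<lambda>p. v' i p * f p + v i p * f' i p)" for i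
    by (rule cell_null_slice_deriv[where F="\<lambda>p. v i p * f p" and i=i]) (intro null_intros v f)+
  from cell_null_sum[where S=UNIV, OF this]
  have "cell_null a b (\<lambda>p. \<Sum>i\<in>UNIV. v' i p * f p + v i p * f' i p)" .
  moreover have "(\<Sum>i\<in>UNIV. v' i p * f p + v i p * f' i p) = (\<Sum>i\<in>UNIV. v i p * f' i p)"
    if "p \<in> slab" for p
    using div[OF that] by (simp add: sum.distrib sum_distrib_right[symmetric])
  ultimately show ?thesis
    by (rule cell_null_cong)
qed

text \<open>All derivatives enter as separate functions tied by \<open>slice_deriv\<close>, which
  turns the identity at a fixed time into algebra with terms of zero integral; e and r stand for
  1/Re and 1/Rm.\<close>

lemma energy_identity:
  fixes u h ut ht DP :: "real^3 \<Rightarrow> real^3" and Du Dh :: "real^3 \<Rightarrow> real^3^3"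
    and D2u D2h :: "3 \<Rightarrow> 3 \<Rightarrow> real^3 \<Rightarrow> real" and P :: "real^3 \<Rightarrow> real" and A r e :: real
  assumes u: "\<And>i j. slice_deriv i (\<lambda>p. u p $ j) (\<lambda>p. Du p $ j $ i)"
      "\<And>j. cell_periodic a b (\<lambda>p. u p $ j)" "\<And>j. wall_zero (\<lambda>p. u p $ j)"
    and h: "\<And>i j. slice_deriv i (\<lambda>p. h p $ j) (\<lambda>p. Dh p $ j $ i)"
      "\<And>j. cell_periodic a b (\<lambda>p. h p $ j)" "\<And>j. wall_zero (\<lambda>p. h p $ j)"
    and D2u: "\<And>i j. slice_deriv i (\<lambda>p. Du p $ j $ i) (D2u i j)" "\<And>i j. cell_periodic a b (\<lambda>p. Du p $ j $ i)"
    and D2h: "\<And>i j. slice_deriv i (\<lambda>p. Dh p $ j $ i) (D2h i j)" "\<And>i j. cell_periodic a b (\<lambda>p. Dh p $ j $ i)"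
    and P: "\<And>i. slice_deriv i P (\<lambda>p. DP p $ i)" "cell_periodic a b P"
    and ut: "\<And>j. continuous_on slab (\<lambda>p. ut p $ j)" and ht: "\<And>j. continuous_on slab (\<lambda>p. ht p $ j)"
    and U: "continuous_on UNIV U" "continuous_on UNIV (deriv U)"
    and Bb: "continuous_on UNIV Bb" "continuous_on UNIV (deriv Bb)"
    and div: "\<And>p. p \<in> slab \<Longrightarrow> (\<Sum>i\<in>UNIV. Du p $ i $ i) = 0" "\<And>p. p \<in> slab \<Longrightarrow> (\<Sum>i\<in>UNIV. Dh p $ i $ i) = 0"
    and momentum: "\<And>p j. p \<in> slab \<Longrightarrow>
      ut p $ j + U (p$3) * Du p $ j $ 1 + (if j = 1 then u p $ 3 * deriv U (p$3) else 0)
        + (\<Sum>i\<in>UNIV. u p $ i * Du p $ j $ i)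
      = A * (Bb (p$3) * Dh p $ j $ 1 + r * Dh p $ j $ 3 + (if j = 1 then h p $ 3 * deriv Bb (p$3) else 0)
          + (\<Sum>i\<in>UNIV. h p $ i * Dh p $ j $ i)) - DP p $ j + e * (\<Sum>i\<in>UNIV. D2u i j p)"
    and induction: "\<And>p j. p \<in> slab \<Longrightarrow>
      ht p $ j + (if j = 1 then u p $ 3 * deriv Bb (p$3) else 0) + U (p$3) * Dh p $ j $ 1
        + (\<Sum>i\<in>UNIV. u p $ i * Dh p $ j $ i) - Bb (p$3) * Du p $ j $ 1 - r * Du p $ j $ 3
        - (if j = 1 then h p $ 3 * deriv U (p$3) else 0) - (\<Sum>i\<in>UNIV. h p $ i * Du p $ j $ i)
      = r * (\<Sum>i\<in>UNIV. D2h i j p)"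
  shows "(LINT p:cell a b|lborel. \<Sum>j\<in>UNIV. u p $ j * ut p $ j + A * (h p $ j * ht p $ j))
    = Iform a b A U Bb u h - e * (\<Sum>j\<in>UNIV. gn2 a b (\<lambda>p. Du p $ j))
      - A * r * (\<Sum>j\<in>UNIV. gn2 a b (\<lambda>p. Dh p $ j))"
proof -
  have U1: "continuous_on {-1..1} U" and B1: "continuous_on {-1..1} Bb"
    using U Bb continuous_on_subset by blast+
  note transport = cell_null_transport[OF _ _ _ _ U1] cell_null_transport[OF _ _ _ _ B1]
  have n1: "cell_null a b (\<lambda>p. U (p$3) * (Du p $ j $ 1 * u p $ j + u p $ j * Du p $ j $ 1))" for j
    by (intro transport u)
  have n2: "cell_null a b (\<lambda>p. U (p$3) * (Dh p $ j $ 1 * h p $ j + h p $ j * Dh p $ j $ 1))" for j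
    by (intro transport h)
  have n3: "cell_null a b (\<lambda>p. Bb (p$3) * (Dh p $ j $ 1 * u p $ j + h p $ j * Du p $ j $ 1))" for j
    by (intro transport h u)
  have n4: "cell_null a b (\<lambda>p. Dh p $ j $ 3 * u p $ j + h p $ j * Du p $ j $ 3)" for j
    by (intro cell_null_vertical h u)
  have n5: "cell_null a b (\<lambda>p. \<Sum>i\<in>UNIV. u p $ i * (Du p $ j $ i * u p $ j + u p $ j * Du p $ j $ i))" for j
    by (rule cell_null_divergence_free[where f="\<lambda>p. u p $ j * u p $ j" and v'="\<lambda>i p. Du p $ i $ i"])
      (intro slice_deriv_mult cell_periodic_mult u div; assumption)+
  have n6: "cell_null a b (\<lambda>p. \<Sum>i\<in>UNIV. u p $ i * (Dh p $ j $ i * h p $ j + h p $ j * Dh p $ j $ i))" for j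
    by (rule cell_null_divergence_free[where f="\<lambda>p. h p $ j * h p $ j" and v'="\<lambda>i p. Du p $ i $ i"])
      (intro slice_deriv_mult cell_periodic_mult u h div; assumption)+
  have n7: "cell_null a b (\<lambda>p. \<Sum>i\<in>UNIV. h p $ i * (Dh p $ j $ i * u p $ j + h p $ j * Du p $ j $ i))" for j
    by (rule cell_null_divergence_free[where f="\<lambda>p. h p $ j * u p $ j" and v'="\<lambda>i p. Dh p $ i $ i"])
      (intro slice_deriv_mult cell_periodic_mult u h div; assumption)+
  have n8: "cell_null a b (\<lambda>p. \<Sum>i\<in>UNIV. u p $ i * DP p $ i)"
    by (rule cell_null_divergence_free[where f=P and v'="\<lambda>i p. Du p $ i $ i"])
      (intro u P div; assumption)+
  have n9: "cell_null a b (\<lambda>p. Du p $ j $ i * Du p $ j $ i + u p $ j * D2u i j p)" for i j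
    by (rule cell_null_slice_deriv[where F="\<lambda>p. u p $ j * Du p $ j $ i" and i=i])
      (intro null_intros u D2u)+
  have n10: "cell_null a b (\<lambda>p. Dh p $ j $ i * Dh p $ j $ i + h p $ j * D2h i j p)" for i j
    by (rule cell_null_slice_deriv[where F="\<lambda>p. h p $ j * Dh p $ j $ i" and i=i])
      (intro null_intros h D2h)+
  \<comment> \<open>Collects the terms of zero integral for one component. The halves appear because
    derivatives of squares are written out twice; the couplings pair A times a Lorentz term with the
    induction equation multiplied by A. The pressure stays apart, since it integrates to zero only
    after summing over j.\<close>
  define T where "T j p =
      (- 1/2) * (U (p$3) * (Du p $ j $ 1 * u p $ j + u p $ j * Du p $ j $ 1))
      + (- A/2) * (U (p$3) * (Dh p $ j $ 1 * h p $ j + h p $ j * Dh p $ j $ 1))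
      + A * (Bb (p$3) * (Dh p $ j $ 1 * u p $ j + h p $ j * Du p $ j $ 1))
      + (A * r) * (Dh p $ j $ 3 * u p $ j + h p $ j * Du p $ j $ 3)
      + (- 1/2) * (\<Sum>i\<in>UNIV. u p $ i * (Du p $ j $ i * u p $ j + u p $ j * Du p $ j $ i))
      + (- A/2) * (\<Sum>i\<in>UNIV. u p $ i * (Dh p $ j $ i * h p $ j + h p $ j * Dh p $ j $ i))
      + A * (\<Sum>i\<in>UNIV. h p $ i * (Dh p $ j $ i * u p $ j + h p $ j * Du p $ j $ i))
      + e * (\<Sum>i\<in>UNIV. Du p $ j $ i * Du p $ j $ i + u p $ j * D2u i j p)
      + (A * r) * (\<Sum>i\<in>UNIV. Dh p $ j $ i * Dh p $ j $ i + h p $ j * D2h i j p)" for j p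
  have T: "cell_null a b (T j)" for j
    unfolding T_def by (intro cell_null_add cell_null_cmult cell_null_sum n1 n2 n3 n4 n5 n6 n7 n9 n10)
  define X where "X p = (\<Sum>j\<in>UNIV. u p $ j * ut p $ j + A * (h p $ j * ht p $ j))" for p
  define Su where "Su j p = (\<Sum>i\<in>UNIV. (Du p $ j $ i)\<^sup>2)" for j p
  define Sh where "Sh j p = (\<Sum>i\<in>UNIV. (Dh p $ j $ i)\<^sup>2)" for j p
  define I1 where "I1 p = deriv U (p$3) * u p $ 3 * u p $ 1" for p
  define I2 where "I2 p = h p $ 3 * deriv Bb (p$3) * u p $ 1" for p
  define I3 where "I3 p = u p $ 3 * deriv Bb (p$3) * h p $ 1" for p
  define I4 where "I4 p = h p $ 3 * deriv U (p$3) * h p $ 1" for p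
  define Y where "Y p = - I1 p + A * (I2 p - I3 p + I4 p) - e * (\<Sum>j\<in>UNIV. Su j p) - A * r * (\<Sum>j\<in>UNIV. Sh j p)" for p
  have pointwise: "(\<Sum>j\<in>UNIV. T j p) - (\<Sum>j\<in>UNIV. u p $ j * DP p $ j) = X p - Y p" if p: "p \<in> slab" for p
  proof -
    \<comment> \<open>The terms along the unit vector in x, which make up the integrand of I, enter
      only the first component.\<close>
    define \<delta> where "\<delta> j = (if j = 1 then - I1 p + A * (I2 p - I3 p + I4 p) else 0)" for j :: 3
    have "T j p - u p $ j * DP p $ j
        = u p $ j * ut p $ j + A * (h p $ j * ht p $ j) - \<delta> j + e * Su j p + A * r * Sh j p" for j
    proof -
      have m: "ut p $ j = A * (Bb (p$3) * Dh p $ j $ 1 + r * Dh p $ j $ 3 + (if j = 1 then h p $ 3 * deriv Bb (p$3) else 0)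
          + (\<Sum>i\<in>UNIV. h p $ i * Dh p $ j $ i)) - DP p $ j + e * (\<Sum>i\<in>UNIV. D2u i j p)
          - U (p$3) * Du p $ j $ 1 - (if j = 1 then u p $ 3 * deriv U (p$3) else 0)
        - (\<Sum>i\<in>UNIV. u p $ i * Du p $ j $ i)"
        using momentum[OF p, of j] by linarith
      have n: "ht p $ j = r * (\<Sum>i\<in>UNIV. D2h i j p) - (if j = 1 then u p $ 3 * deriv Bb (p$3) else 0) - U (p$3) * Dh p $ j $ 1
        - (\<Sum>i\<in>UNIV. u p $ i * Dh p $ j $ i) + Bb (p$3) * Du p $ j $ 1 + r * Du p $ j $ 3
        + (if j = 1 then h p $ 3 * deriv U (p$3) else 0) + (\<Sum>i\<in>UNIV. h p $ i * Du p $ j $ i)"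
        using induction[OF p, of j] by linarith
      show ?thesis
        unfolding m n T_def \<delta>_def Su_def Sh_def I1_def I2_def I3_def I4_def sum_3
        by (cases "j = 1") (simp_all add: algebra_simps power2_eq_square)
    qed
    then have "(\<Sum>j\<in>UNIV. T j p - u p $ j * DP p $ j) = (\<Sum>j\<in>UNIV.
        u p $ j * ut p $ j + A * (h p $ j * ht p $ j) - \<delta> j + e * Su j p + A * r * Sh j p)"
      by simp
    also have "\<dots> = X p - (\<Sum>j\<in>UNIV. \<delta> j) + e * (\<Sum>j\<in>UNIV. Su j p) + A * r * (\<Sum>j\<in>UNIV. Sh j p)"
      by (simp add: X_def sum.distrib sum_subtractf sum_distrib_left)
    also have "(\<Sum>j\<in>UNIV. \<delta> j) = - I1 p + A * (I2 p - I3 p + I4 p)"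
      by (simp add: \<delta>_def sum_3)
    finally show ?thesis by (simp add: Y_def sum_subtractf)
  qed
  have "cell_null a b (\<lambda>p. (\<Sum>j\<in>UNIV. T j p) - (\<Sum>j\<in>UNIV. u p $ j * DP p $ j))"
    by (intro cell_null_diff cell_null_sum T n8)
  then have null: "cell_null a b (\<lambda>p. X p - Y p)"
    by (rule cell_null_cong) (rule pointwise)
  have uc: "continuous_on slab (\<lambda>p. u p $ j)" "continuous_on slab (\<lambda>p. Du p $ j $ i)" for i j
    using u(1)[of i j] by (auto simp: slice_deriv_def)
  have hc: "continuous_on slab (\<lambda>p. h p $ j)" "continuous_on slab (\<lambda>p. Dh p $ j $ i)" for i j
    using h(1)[of i j] by (auto simp: slice_deriv_def)
  have prof: "continuous_on slab (\<lambda>p. deriv U (p$3))" "continuous_on slab (\<lambda>p. deriv Bb (p$3))"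
    by (rule continuous_on_compose2[OF U(2)] continuous_on_compose2[OF Bb(2)]; auto intro!: continuous_intros)+
  have cX: "continuous_on slab X" unfolding X_def by (intro continuous_intros uc hc ut ht)
  have cS: "continuous_on slab (Su j)" "continuous_on slab (Sh j)" for j
    unfolding Su_def Sh_def by (intro continuous_intros uc hc)+
  have cI: "continuous_on slab I1" "continuous_on slab I2" "continuous_on slab I3" "continuous_on slab I4"
    unfolding I1_def I2_def I3_def I4_def by (intro continuous_intros uc hc prof)+
  have cY: "continuous_on slab Y" unfolding Y_def by (intro continuous_intros cI cS)
  let ?L = "\<lambda>F :: real^3 \<Rightarrow> real. LINT p:cell a b|lborel. F p"
  have "?L X - ?L Y = 0"
    using null cell_integrable[OF cX] cell_integrable[OF cY] by (simp add: cell_null_def)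
  moreover have "?L Y = - ?L I1 + A * (?L I2 - ?L I3 + ?L I4)
      - e * (\<Sum>j\<in>UNIV. ?L (Su j)) - A * r * (\<Sum>j\<in>UNIV. ?L (Sh j))"
  proof -
    have "set_integrable lborel (cell a b) F" if "F \<in> {I1, I2, I3, I4} \<union> range Su \<union> range Sh" for F
      using that by (auto intro!: cell_integrable cI cS)
    then show ?thesis
      unfolding Y_def set_lebesgue_integral_def set_integrable_def
      by (simp add: sum_3 distrib_left right_diff_distrib mult.left_commute[of "indicator _ _"])
  qed
  moreover have "?L (Su j) = gn2 a b (\<lambda>p. Du p $ j)" "?L (Sh j) = gn2 a b (\<lambda>p. Dh p $ j)" for j
    by (simp_all add: Su_def Sh_def gn2_def norm_vec_square)
  moreover have "Iform a b A U Bb u h = - ?L I1 + A * (?L I2 - ?L I3 + ?L I4)"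
    by (simp add: Iform_def ip_def I1_def I2_def I3_def I4_def)
  ultimately show ?thesis
    unfolding X_def by simp
qed

end

section \<open>Partial derivatives within the space-time domain\<close>

lemma pd_line:
  assumes F: "F differentiable (at (\<gamma> s) within Dom)"
    and \<gamma>: "(\<gamma> has_vector_derivative v) (at s within S)" and S: "\<And>\<sigma>. \<sigma> \<in> S \<Longrightarrow> \<gamma> \<sigma> \<in> Dom"
  shows "((\<lambda>\<sigma>. F (\<gamma> \<sigma>)) has_vector_derivative pd v F (\<gamma> s)) (at s within S)"
proof -
  let ?D = "frechet_derivative F (at (\<gamma> s) within Dom)"
  have D: "(F has_derivative ?D) (at (\<gamma> s) within Dom)"
    using F frechet_derivative_works by blast
  have "(F has_derivative ?D) (at (\<gamma> s) within \<gamma> ` S)"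
    by (rule has_derivative_subset[OF D]) (use S in auto)
  from has_derivative_in_compose[OF \<gamma>[unfolded has_vector_derivative_def] this]
  show ?thesis
    unfolding has_vector_derivative_def pd_def
    by (simp add: linear_scale[OF has_derivative_linear[OF D]])
qed

lemma has_vector_derivative_slice:
  "((\<lambda>\<sigma>. (p + \<sigma> *\<^sub>R axis i 1, t)) has_vector_derivative sdir i) (at s within S)"
  unfolding sdir_def by (auto intro!: derivative_eq_intros)

lemma pd_slice:
  assumes "C1_Dom F" "0 \<le> t" "p + s *\<^sub>R axis i 1 \<in> slab"
  shows "((\<lambda>\<sigma>. F (p + \<sigma> *\<^sub>R axis i 1, t)) has_vector_derivative pd (sdir i) F (p + s *\<^sub>R axis i 1, t))
    (at s within {\<sigma>. p + \<sigma> *\<^sub>R axis i 1 \<in> slab})"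
  by (rule pd_line[OF _ has_vector_derivative_slice])
    (use assms in \<open>auto simp: C1_Dom_def Dom_def slab_def abs_le_iff\<close>)

lemma has_vector_derivative_vec_nth:
  "(f has_vector_derivative f') F \<Longrightarrow> ((\<lambda>x. f x $ j) has_vector_derivative f' $ j) F"
  by (rule bounded_linear.has_vector_derivative[OF bounded_linear_vec_nth])

lemma C1_Dom_continuous:
  assumes "C1_Dom F"
  shows "continuous_on Dom F" "continuous_on Dom (pd v F)"
proof -
  show "continuous_on Dom F"
    using assms differentiable_imp_continuous_within
    by (auto simp: C1_Dom_def continuous_on_eq_continuous_within)
  show "continuous_on Dom (pd v F)"
    using assms unfolding C1_Dom_def by blast
qed

lemma continuous_on_slab_at:
  assumes "continuous_on Dom F" "0 \<le> t"
  shows "continuous_on slab (\<lambda>p. F (p, t))"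
  by (rule continuous_on_compose2[OF assms(1)])
    (use assms(2) in \<open>auto simp: Dom_def slab_def abs_le_iff intro!: continuous_intros\<close>)

lemma slice_deriv_pd:
  assumes F: "C1_Dom (F :: pt \<Rightarrow> real^3)" and t: "0 \<le> t"
  shows "slice_deriv i (\<lambda>p. F (p, t) $ j) (\<lambda>p. pd (sdir i) F (p, t) $ j)"
  unfolding slice_deriv_def has_real_derivative_iff_has_vector_derivative
  using has_vector_derivative_vec_nth[OF pd_slice[OF F t]]
  by (auto intro!: continuous_intros continuous_on_slab_at C1_Dom_continuous F t)

lemma slice_deriv_pd_scalar:
  assumes F: "C1_Dom (F :: pt \<Rightarrow> real)" and t: "0 \<le> t"
  shows "slice_deriv i (\<lambda>p. F (p, t)) (\<lambda>p. pd (sdir i) F (p, t))"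
  unfolding slice_deriv_def has_real_derivative_iff_has_vector_derivative
  using pd_slice[OF F t]
  by (auto intro!: continuous_on_slab_at C1_Dom_continuous F t)

text \<open>In the vertical direction, a point in the lower half has room 1 above it and any other
  point room 1 below. So derivatives along lines in the slab are unique even on the walls, which is
  how \<open>pd\<close> values are identified.\<close>

lemma at_within_slab_line_nontrivial:
  assumes "p \<in> slab"
  shows "at 0 within {\<sigma>. p + \<sigma> *\<^sub>R axis i 1 \<in> slab} \<noteq> bot"
proof (cases "p$3 \<le> 0")
  case True
  then have "at 0 within {0..1} \<le> at 0 within {\<sigma>. p + \<sigma> *\<^sub>R axis i 1 \<in> slab}"
    using assms by (intro at_le) (auto simp: slab_def axis_def)
  then show ?thesis
    by (auto simp: at_within_Icc_at_right trivial_limit_at_right_real bot_unique)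
next
  case False
  then have "at 0 within {-1..0} \<le> at 0 within {\<sigma>. p + \<sigma> *\<^sub>R axis i 1 \<in> slab}"
    using assms by (intro at_le) (auto simp: slab_def axis_def)
  then show ?thesis
    by (auto simp: at_within_Icc_at_left trivial_limit_at_left_real bot_unique)
qed

text \<open>\<open>frechet_derivative\<close> is a choice of some derivative, so it need not commute
  with projections by definition; both sides differentiate the same function of one
  variable.\<close>

lemma pd_component:
  assumes F: "C1_Dom (F :: pt \<Rightarrow> real^3)" and t: "0 \<le> t" and p: "p \<in> slab"
  shows "pd (sdir i) (\<lambda>r. F r $ j) (p, t) = pd (sdir i) F (p, t) $ j"
proof (rule vector_derivative_unique_within[OF at_within_slab_line_nontrivial[OF p]])
  let ?S = "{\<sigma>. p + \<sigma> *\<^sub>R axis i 1 \<in> slab}"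
  have q: "p + 0 *\<^sub>R axis i 1 \<in> slab" using p by simp
  show "((\<lambda>\<sigma>. F (p + \<sigma> *\<^sub>R axis i 1, t) $ j) has_vector_derivative pd (sdir i) F (p, t) $ j) (at 0 within ?S)"
    using has_vector_derivative_vec_nth[OF pd_slice[OF F t q]] by simp
  have "F differentiable (at (p, t) within Dom)"
    using F t p by (auto simp: C1_Dom_def Dom_def slab_def abs_le_iff)
  then have "(\<lambda>r. F r $ j) differentiable (at (p + 0 *\<^sub>R axis i 1, t) within Dom)"
    unfolding differentiable_def by (auto intro: bounded_linear.has_derivative[OF bounded_linear_vec_nth])
  from pd_line[where \<gamma>="\<lambda>\<sigma>. (p + \<sigma> *\<^sub>R axis i 1, t)" and s=0, OF this has_vector_derivative_slice, of ?S]
  show "((\<lambda>\<sigma>. F (p + \<sigma> *\<^sub>R axis i 1, t) $ j) has_vector_derivative pd (sdir i) (\<lambda>r. F r $ j) (p, t)) (at 0 within ?S)"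
    using t by (simp add: Dom_def slab_def abs_le_iff)
qed

text \<open>A horizontal shift d does not change the set of admissible line parameters, so both
  derivatives are taken within the same set and agree by uniqueness.\<close>

lemma pd_periodic:
  assumes F: "C1_Dom F" and t: "0 \<le> t" and p: "p \<in> slab" and d: "d$3 = 0"
    and per: "\<And>p. p \<in> slab \<Longrightarrow> F (p + d, t) = F (p, t)"
  shows "pd (sdir i) F (p + d, t) = pd (sdir i) F (p, t)"
proof (rule vector_derivative_unique_within[OF at_within_slab_line_nontrivial[OF p]])
  let ?S = "{\<sigma>. p + \<sigma> *\<^sub>R axis i 1 \<in> slab}"
  have S: "{\<sigma>. (p + d) + \<sigma> *\<^sub>R axis i 1 \<in> slab} = ?S"
    using d by (auto simp: slab_def)
  have q: "p + 0 *\<^sub>R axis i 1 \<in> slab" "p + d + 0 *\<^sub>R axis i 1 \<in> slab"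
    using p d by (auto simp: slab_def)
  show "((\<lambda>\<sigma>. F (p + \<sigma> *\<^sub>R axis i 1, t)) has_vector_derivative pd (sdir i) F (p, t)) (at 0 within ?S)"
    using pd_slice[OF F t q(1)] by simp
  have "((\<lambda>\<sigma>. F (p + d + \<sigma> *\<^sub>R axis i 1, t)) has_vector_derivative pd (sdir i) F (p + d, t)) (at 0 within ?S)"
    using pd_slice[OF F t q(2)] unfolding S by simp
  then show "((\<lambda>\<sigma>. F (p + \<sigma> *\<^sub>R axis i 1, t)) has_vector_derivative pd (sdir i) F (p + d, t)) (at 0 within ?S)"
  proof (rule has_vector_derivative_transform[rotated 2])
    show "F (p + \<sigma> *\<^sub>R axis i 1, t) = F (p + d + \<sigma> *\<^sub>R axis i 1, t)" if "\<sigma> \<in> ?S" for \<sigma>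
      using per[of "p + \<sigma> *\<^sub>R axis i 1"] that by (simp add: algebra_simps)
  qed (use q in simp)
qed

lemma has_vector_derivative_pd_time:
  assumes F: "C1_Dom F" and p: "p \<in> slab" and t: "0 \<le> t"
  shows "((\<lambda>\<tau>. F (p, \<tau>)) has_vector_derivative pd tdir F (p, t)) (at t within {0..})"
proof (rule pd_line[where \<gamma>="\<lambda>\<tau>. (p, \<tau>)"])
  show "F differentiable (at (p, t) within Dom)"
    using assms by (auto simp: C1_Dom_def Dom_def slab_def abs_le_iff)
  show "(Pair p has_vector_derivative tdir) (at t within {0..})"
    unfolding tdir_def has_vector_derivative_def
    by (auto intro!: derivative_eq_intros)
  show "(p, \<tau>) \<in> Dom" if "\<tau> \<in> {0..}" for \<tau>
    using that p by (auto simp: Dom_def slab_def abs_le_iff)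
qed

section \<open>Time derivative of the energy and its integration\<close>

lemma energy_has_derivative:
  assumes a: "0 < a" and b: "0 < b" and u: "C1_Dom u" and h: "C1_Dom h" and t: "0 \<le> t"
  shows "(energy a b A u h has_real_derivative
      (LINT p:cell a b|lborel. \<Sum>j\<in>UNIV. u (p, t) $ j * pd tdir u (p, t) $ j + A * (h (p, t) $ j * pd tdir h (p, t) $ j)))
    (at t within {0..})"
proof -
  define f where "f \<tau> p = (norm (u (p, \<tau>)))\<^sup>2 + A * (norm (h (p, \<tau>)))\<^sup>2" for \<tau> p
  define f' where "f' \<tau> p = 2 * (\<Sum>j\<in>UNIV. u (p, \<tau>) $ j * pd tdir u (p, \<tau>) $ j
      + A * (h (p, \<tau>) $ j * pd tdir h (p, \<tau>) $ j))" for \<tau> p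
  let ?lo = "vector [0, 0, -1] :: real^3" and ?hi = "vector [2*pi/a, 2*pi/b, 1] :: real^3"
  have cell: "p \<in> slab" if "p \<in> cbox ?lo ?hi" for p
    using that cell_subset_slab[OF a b] by (auto simp: cell_eq_cbox)
  note cont = C1_Dom_continuous[OF u] C1_Dom_continuous[OF h]
  have slab_int: "set_integrable lborel (cell a b) (\<lambda>p. G (p, \<tau>))" if "continuous_on Dom G" "0 \<le> \<tau>" for G :: "pt \<Rightarrow> real" and \<tau>
    using cell_integrable[OF a b continuous_on_slab_at[OF that]] .
  have int_f: "set_integrable lborel (cell a b) (\<lambda>p. (norm (u (p, \<tau>)))\<^sup>2)"
    "set_integrable lborel (cell a b) (\<lambda>p. A * (norm (h (p, \<tau>)))\<^sup>2)" if "0 \<le> \<tau>" for \<tau>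
    by (rule slab_int[of "\<lambda>q. (norm (u q))\<^sup>2"] slab_int[of "\<lambda>q. A * (norm (h q))\<^sup>2"];
        intro continuous_intros cont that)+
  have int_f': "set_integrable lborel (cell a b) (f' t)"
    unfolding f'_def
    by (rule slab_int[of "\<lambda>q. 2 * (\<Sum>j\<in>UNIV. u q $ j * pd tdir u q $ j + A * (h q $ j * pd tdir h q $ j))"])
      (intro continuous_intros cont t)+
  \<comment> \<open>The Leibniz rule speaks of the gauge integral over a box, hence the passage from
    the Lebesgue integral and back.\<close>
  have E: "energy a b A u h \<tau> = 1/2 * integral (cbox ?lo ?hi) (f \<tau>)" and int: "f \<tau> integrable_on cbox ?lo ?hi"
    if "0 \<le> \<tau>" for \<tau>
  proof -
    have "set_integrable lborel (cell a b) (f \<tau>)"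
      unfolding f_def by (intro set_integral_add(1) int_f that)
    note * = set_borel_integral_eq_integral[OF this]
    show "f \<tau> integrable_on cbox ?lo ?hi" using * by (simp add: cell_eq_cbox)
    have "energy a b A u h \<tau> = 1/2 * (LINT p:cell a b|lborel. f \<tau> p)"
      using int_f[OF that] by (simp add: energy_def f_def set_integral_add)
    then show "energy a b A u h \<tau> = 1/2 * integral (cbox ?lo ?hi) (f \<tau>)"
      using * by (simp add: cell_eq_cbox)
  qed
  have "((\<lambda>\<tau>. integral (cbox ?lo ?hi) (f \<tau>)) has_vector_derivative integral (cbox ?lo ?hi) (f' t)) (at t within {0..})"
  proof (rule leibniz_rule_vector_derivative)
    fix \<tau> p assume \<tau>: "\<tau> \<in> {0::real..}" and p: "p \<in> cbox ?lo ?hi"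
    have d: "((\<lambda>\<tau>. u (p, \<tau>) $ j) has_real_derivative pd tdir u (p, \<tau>) $ j) (at \<tau> within {0..})"
      "((\<lambda>\<tau>. h (p, \<tau>) $ j) has_real_derivative pd tdir h (p, \<tau>) $ j) (at \<tau> within {0..})" for j
      unfolding has_real_derivative_iff_has_vector_derivative
      by (intro has_vector_derivative_vec_nth has_vector_derivative_pd_time u h; use \<tau> cell[OF p] in simp)+
    have "((\<lambda>\<tau>. f \<tau> p) has_real_derivative f' \<tau> p) (at \<tau> within {0..})"
      unfolding f_def f'_def norm_vec_square sum_3
      by (auto intro!: derivative_eq_intros d simp: algebra_simps)
    then show "((\<lambda>\<tau>. f \<tau> p) has_vector_derivative f' \<tau> p) (at \<tau> within {0..})"
      by (simp add: has_real_derivative_iff_has_vector_derivative)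
  next
    have comp: "continuous_on ({0..} \<times> cbox ?lo ?hi) (\<lambda>x. G (snd x, fst x))"
      if "continuous_on Dom G" for G :: "pt \<Rightarrow> real^3"
      by (rule continuous_on_compose2[OF that])
        (use cell in \<open>auto simp: Dom_def slab_def abs_le_iff intro!: continuous_intros\<close>)
    show "continuous_on ({0..} \<times> cbox ?lo ?hi) (\<lambda>(\<tau>, p). f' \<tau> p)"
      unfolding f'_def case_prod_unfold
      by (intro continuous_intros comp cont)
  qed (use int t in auto)
  then have "((\<lambda>\<tau>. 1/2 * integral (cbox ?lo ?hi) (f \<tau>)) has_real_derivative 1/2 * integral (cbox ?lo ?hi) (f' t)) (at t within {0..})"
    by (intro DERIV_cmult) (simp add: has_real_derivative_iff_has_vector_derivative)
  also have "1/2 * integral (cbox ?lo ?hi) (f' t) = 1/2 * (LINT p:cell a b|lborel. f' t p)"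
    using set_borel_integral_eq_integral[OF int_f'] by (simp add: cell_eq_cbox)
  also have "\<dots> = (LINT p:cell a b|lborel. \<Sum>j\<in>UNIV. u (p, t) $ j * pd tdir u (p, t) $ j + A * (h (p, t) $ j * pd tdir h (p, t) $ j))"
    unfolding f'_def by simp
  \<comment> \<open>The integral formula for the energy holds only at times \<ge> 0, so the
    derivative is transferred within that half-line.\<close>
  finally show ?thesis
    by (rule has_field_derivative_transform_within[where d=1]) (use t E in auto)
qed

text \<open>The factor exp(- k t) makes E(t) exp(- k t) nonincreasing by the mean value theorem. The
  rate k may have either sign and is negative in the application.\<close>

lemma gronwall_decay:
  fixes E :: "real \<Rightarrow> real"
  assumes E: "\<And>t. 0 \<le> t \<Longrightarrow> (E has_real_derivative E' t) (at t within {0..})"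
    and E': "\<And>t. 0 \<le> t \<Longrightarrow> E' t \<le> k * E t" and t: "0 \<le> t"
  shows "E t \<le> E 0 * exp (k * t)"
proof (cases "t = 0")
  case False
  define g where "g s = E s * exp (- k * s)" for s
  define g' where "g' s = (E' s - k * E s) * exp (- k * s)" for s
  have "(g has_derivative (\<lambda>x. x * g' s)) (at s within {0..t})" if "0 \<le> s" "s \<le> t" for s
  proof -
    have "(E has_real_derivative E' s) (at s within {0..t})"
      by (rule DERIV_subset[OF E]) (use that in auto)
    then have "(g has_real_derivative g' s) (at s within {0..t})"
      unfolding g_def g'_def by (auto intro!: derivative_eq_intros simp: algebra_simps)
    then show ?thesis
      by (simp only: has_field_derivative_def mult.commute[of _ "g' s"])
  qed
  from mvt_simple[OF _ this] obtain s where s: "0 < s" "s < t" "g t - g 0 = (t - 0) * g' s"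
    using t False by force
  have "g' s \<le> 0"
    unfolding g'_def using E'[of s] s by (intro mult_nonpos_nonneg) auto
  then have "g t \<le> g 0"
    using s mult_nonneg_nonpos[of t "g' s"] by simp
  then have "E t * exp (- k * t) * exp (k * t) \<le> E 0 * exp (k * t)"
    by (intro mult_right_mono) (auto simp: g_def)
  then show ?thesis by (simp add: mult.assoc exp_add[symmetric])
qed simp

section \<open>Decay of perturbations\<close>

definition jacobian :: "(pt \<Rightarrow> real^3) \<Rightarrow> real \<Rightarrow> real^3 \<Rightarrow> real^3^3" where
  "jacobian u t p = (\<chi> j i. pd (sdir i) u (p, t) $ j)"

text \<open>The regularity, periodicity and wall conditions that u and h have in common, so that
  each consequence is proved once for both.\<close>

definition boundary_field :: "real \<Rightarrow> real \<Rightarrow> (pt \<Rightarrow> real^3) \<Rightarrow> bool" where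
  "boundary_field a b u \<longleftrightarrow> C2_Dom u \<and>
    (\<forall>p t. (p, t) \<in> Dom \<longrightarrow> u (p + axis 1 (2*pi/a), t) = u (p, t) \<and> u (p + axis 2 (2*pi/b), t) = u (p, t)) \<and>
    (\<forall>p t. 0 \<le> t \<and> \<bar>p$3\<bar> = 1 \<longrightarrow> u (p, t) = 0)"

lemma Dom_iff_slab: "(p, t) \<in> Dom \<longleftrightarrow> p \<in> slab \<and> 0 \<le> t"
  by (auto simp: Dom_def slab_def abs_le_iff)

lemma boundary_field_slices:
  assumes u: "boundary_field a b u" and t: "0 \<le> t"
  shows "slice_deriv i (\<lambda>p. u (p, t) $ j) (\<lambda>p. jacobian u t p $ j $ i)"
    and "cell_periodic a b (\<lambda>p. u (p, t) $ j)"
    and "wall_zero (\<lambda>p. u (p, t) $ j)"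
    and "slice_deriv i (\<lambda>p. jacobian u t p $ j $ i) (\<lambda>p. pd (sdir i) (pd (sdir i) u) (p, t) $ j)"
    and "cell_periodic a b (\<lambda>p. jacobian u t p $ j $ i)"
    and "continuous_on slab (\<lambda>p. pd tdir u (p, t) $ j)"
proof -
  have C1: "C1_Dom u" and C1': "C1_Dom (pd v u)" for v
    using u unfolding boundary_field_def C2_Dom_def by blast+
  have per: "u (p + axis 1 (2*pi/a), t) = u (p, t)" "u (p + axis 2 (2*pi/b), t) = u (p, t)" if "p \<in> slab" for p
    using u t that by (auto simp: boundary_field_def Dom_iff_slab)
  show "slice_deriv i (\<lambda>p. u (p, t) $ j) (\<lambda>p. jacobian u t p $ j $ i)"
    unfolding jacobian_def using slice_deriv_pd[OF C1 t] by simp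
  show "cell_periodic a b (\<lambda>p. u (p, t) $ j)"
    using per by (simp add: cell_periodic_def)
  show "wall_zero (\<lambda>p. u (p, t) $ j)"
    using u t by (auto simp: wall_zero_def boundary_field_def)
  show "slice_deriv i (\<lambda>p. jacobian u t p $ j $ i) (\<lambda>p. pd (sdir i) (pd (sdir i) u) (p, t) $ j)"
    unfolding jacobian_def using slice_deriv_pd[OF C1' t] by simp
  show "cell_periodic a b (\<lambda>p. jacobian u t p $ j $ i)"
    unfolding cell_periodic_def jacobian_def
    using pd_periodic[OF C1 t, of _ "axis 1 (2*pi/a)" i] pd_periodic[OF C1 t, of _ "axis 2 (2*pi/b)" i] per
    by (simp add: axis_def)
  show "continuous_on slab (\<lambda>p. pd tdir u (p, t) $ j)"
    by (intro continuous_intros continuous_on_slab_at C1_Dom_continuous C1 t)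
qed

text \<open>This makes a classical perturbation, frozen at one time, usable in the variational
  problem that defines the critical Reynolds number.\<close>

lemma boundary_field_H1_adm:
  assumes u: "boundary_field a b u" and t: "0 \<le> t"
  shows "H1_adm a b (\<lambda>p. zero_ext (\<lambda>p. u (p, t)) p $ j) (\<lambda>p. zero_ext (jacobian u t) p $ j)"
proof -
  have "H1_adm a b (zero_ext (\<lambda>p. u (p, t) $ j)) (zero_ext (\<lambda>p. jacobian u t p $ j))"
    using boundary_field_slices[OF u t]
    by (intro H1_adm_zero_ext) (auto simp: cell_periodic_def wall_zero_def)
  moreover have "zero_ext (\<lambda>p. u (p, t) $ j) = (\<lambda>p. zero_ext (\<lambda>p. u (p, t)) p $ j)"
    "zero_ext (\<lambda>p. jacobian u t p $ j) = (\<lambda>p. zero_ext (jacobian u t) p $ j)"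
    by (auto simp: zero_ext_def)
  ultimately show ?thesis by simp
qed

lemma LINT_cell_zero_ext:
  assumes "0 < a" "0 < b" and "\<And>p. p \<in> slab \<Longrightarrow> F p = G p"
  shows "(LINT p:cell a b|lborel. F p) = (LINT p:cell a b|lborel. G p)"
  using assms(3) cell_subset_slab[OF assms(1,2)]
  by (intro set_lebesgue_integral_cong) (auto simp: cell_borel)

lemma gn2_zero_ext:
  assumes "0 < a" "0 < b"
  shows "gn2 a b (\<lambda>p. zero_ext D p $ j) = gn2 a b (\<lambda>p. D p $ j)"
  unfolding gn2_def by (rule LINT_cell_zero_ext[OF assms]) (simp add: zero_ext_def)

lemma Iform_zero_ext:
  assumes "0 < a" "0 < b"
  shows "Iform a b A U Bb (zero_ext u) (zero_ext h) = Iform a b A U Bb u h"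
proof -
  have "ip a b F G = ip a b F' G'" if "\<And>p. p \<in> slab \<Longrightarrow> F p * G p = F' p * G' p" for F G F' G'
    unfolding ip_def by (rule LINT_cell_zero_ext[OF assms that])
  note ip_eq = this
  have "ip a b (\<lambda>p. deriv U (p$3) * zero_ext u p $ 3) (\<lambda>p. zero_ext u p $ 1) = ip a b (\<lambda>p. deriv U (p$3) * u p $ 3) (\<lambda>p. u p $ 1)"
    "ip a b (\<lambda>p. zero_ext h p $ 3 * deriv Bb (p$3)) (\<lambda>p. zero_ext u p $ 1) = ip a b (\<lambda>p. h p $ 3 * deriv Bb (p$3)) (\<lambda>p. u p $ 1)"
    "ip a b (\<lambda>p. zero_ext u p $ 3 * deriv Bb (p$3)) (\<lambda>p. zero_ext h p $ 1) = ip a b (\<lambda>p. u p $ 3 * deriv Bb (p$3)) (\<lambda>p. h p $ 1)"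
    "ip a b (\<lambda>p. zero_ext h p $ 3 * deriv U (p$3)) (\<lambda>p. zero_ext h p $ 1) = ip a b (\<lambda>p. h p $ 3 * deriv U (p$3)) (\<lambda>p. h p $ 1)"
    by (rule ip_eq; simp add: zero_ext_def)+
  then show ?thesis
    unfolding Iform_def by (simp only:)
qed

context
  fixes a b Ha Pm :: real and U Bb :: "real \<Rightarrow> real"
  assumes a: "0 < a" and b: "0 < b" and Ha: "0 < Ha" and Pm: "0 < Pm"
    and U: "continuous_on UNIV U" "continuous_on UNIV (deriv U)"
    and Bb: "continuous_on UNIV Bb" "continuous_on UNIV (deriv Bb)"
begin

text \<open>The defining inequality of the supremum with the denominator cleared, so that it
  includes pairs for which the quotient is degenerate.\<close>

lemma Iform_le_ReE:
  assumes u: "\<And>j. H1_adm a b (\<lambda>p. u p $ j) (\<lambda>p. Du p $ j)"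
    and h: "\<And>j. H1_adm a b (\<lambda>p. h p $ j) (\<lambda>p. Dh p $ j)"
    and div: "\<And>p. (\<Sum>i\<in>UNIV. Du p $ i $ i) = 0" "\<And>p. (\<Sum>i\<in>UNIV. Dh p $ i $ i) = 0"
  shows "Iform a b (Ha\<^sup>2 * Pm) U Bb u h \<le> 1 / ReE a b Ha Pm U Bb * D1form a b Ha Du Dh"
proof -
  let ?I = "Iform a b (Ha\<^sup>2 * Pm) U Bb" and ?D = "D1form a b Ha"
  obtain C where C: "0 \<le> C" "\<And>u h :: real^3 \<Rightarrow> real^3. \<And>Du Dh :: real^3 \<Rightarrow> real^3^3.
      (\<And>j. H1_adm a b (\<lambda>p. u p $ j) (\<lambda>p. Du p $ j)) \<Longrightarrow> (\<And>j. H1_adm a b (\<lambda>p. h p $ j) (\<lambda>p. Dh p $ j)) \<Longrightarrow>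
      \<bar>?I u h\<bar> \<le> C * ?D Du Dh"
    using Iform_bound[OF U(2) Bb(2), of "Ha\<^sup>2 * Pm" Ha a b] Ha Pm by auto
  define R where "R = {?I u h / ?D Du Dh | u Du h Dh. adm a b u Du h Dh}"
  \<comment> \<open>Inverting twice returns the supremum even if it is 0, since 1 / 0 = 0.\<close>
  have m: "1 / ReE a b Ha Pm U Bb = Sup R"
    by (simp add: ReE_def R_def)
  have "bdd_above R"
  proof (rule bdd_aboveI[of _ C])
    fix x assume "x \<in> R"
    then obtain u Du h Dh where x: "x = ?I u h / ?D Du Dh" and adm: "adm a b u Du h Dh"
      by (auto simp: R_def)
    have "?I u h \<le> C * ?D Du Dh"
      using C(2)[of u Du h Dh] adm by (auto simp: adm_def abs_le_iff)
    then show "x \<le> C"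
      using C(1) D1form_nonneg[of a b Ha Du Dh] unfolding x
      by (cases "?D Du Dh = 0") (auto simp: divide_le_eq)
  qed
  show ?thesis
  \<comment> \<open>If D1 = 0, the supremum says nothing, but |I| \<le> C D1 forces I = 0.\<close>
  proof (cases "?D Du Dh = 0")
    case True
    then show ?thesis using C(2)[OF u h] by simp
  next
    case False
    then have D: "0 < ?D Du Dh" using D1form_nonneg[of a b Ha Du Dh] by simp
    let ?su = "\<Sum>j\<in>UNIV. gn2 a b (\<lambda>p. Du p $ j)" and ?sh = "\<Sum>j\<in>UNIV. gn2 a b (\<lambda>p. Dh p $ j)"
    have s0: "0 \<le> ?su" "0 \<le> ?sh" by (auto intro!: sum_nonneg gn2_nonneg)
    \<comment> \<open>D1 is built from some of the summands of the full gradient norms, so D1 > 0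
      yields the nontriviality demanded of competitors.\<close>
    have "0 < ?su \<or> 0 < ?sh"
    proof (rule ccontr)
      assume "\<not> ?thesis"
      then have "?su = 0" "?sh = 0" using s0 by auto
      then have "gn2 a b (\<lambda>p. Du p $ j) = 0" "gn2 a b (\<lambda>p. Dh p $ j) = 0" for j
        by (simp_all add: sum_nonneg_eq_0_iff gn2_nonneg)
      then show False using D by (simp add: D1form_def)
    qed
    then have "0 < sqrt ?su + sqrt ?sh"
      using s0 by (auto intro: add_pos_nonneg add_nonneg_pos)
    then have "adm a b u Du h Dh"
      using u h div by (simp add: adm_def)
    then have "?I u h / ?D Du Dh \<in> R" by (auto simp: R_def)
    then have "?I u h / ?D Du Dh \<le> Sup R"
      using \<open>bdd_above R\<close> by (rule cSup_upper)
    then show ?thesis using D m by (simp add: divide_le_eq)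
  qed
qed

text \<open>The factor \<open>max 1 Pm\<close> compares weights: u has weight 1 in energy and
  dissipation, while h has \<open>Ha\<^sup>2 * Pm\<close> in the energy and only
  \<open>Ha\<^sup>2\<close> in the dissipation.\<close>

lemma dissipation_bound:
  fixes u h :: "real^3 \<Rightarrow> real^3" and Du Dh :: "real^3 \<Rightarrow> real^3^3"
  assumes u: "\<And>j. H1_adm a b (\<lambda>p. u p $ j) (\<lambda>p. Du p $ j)"
    and h: "\<And>j. H1_adm a b (\<lambda>p. h p $ j) (\<lambda>p. Dh p $ j)"
  shows "(LINT p:cell a b|lborel. (norm (u p))\<^sup>2) + Ha\<^sup>2 * Pm * (LINT p:cell a b|lborel. (norm (h p))\<^sup>2)
    \<le> 25 * max 1 Pm * ((\<Sum>j\<in>UNIV. gn2 a b (\<lambda>p. Du p $ j)) + Ha\<^sup>2 * (\<Sum>j\<in>UNIV. gn2 a b (\<lambda>p. Dh p $ j)))"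
proof -
  have poincare: "(LINT p:cell a b|lborel. (norm (v p))\<^sup>2) \<le> 25 * (\<Sum>j\<in>UNIV. gn2 a b (\<lambda>p. Dv p $ j))"
    if v: "\<And>j. H1_adm a b (\<lambda>p. v p $ j) (\<lambda>p. Dv p $ j)"
    for v :: "real^3 \<Rightarrow> real^3" and Dv :: "real^3 \<Rightarrow> real^3^3"
  proof -
    have int: "set_integrable lborel (cell a b) (\<lambda>p. (v p $ j)\<^sup>2)" for j
      using L2loc_integrable(2)[OF _ compact_cell, of "\<lambda>p. v p $ j"] v
      by (simp add: set_integrable_def H1_adm_def)
    have "(LINT p:cell a b|lborel. (norm (v p))\<^sup>2) = (\<Sum>j\<in>UNIV. LINT p:cell a b|lborel. (v p $ j)\<^sup>2)"
      using int by (simp add: norm_vec_square sum_3 set_integral_add)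
    also have "\<dots> \<le> (\<Sum>j\<in>UNIV. 25 * gn2 a b (\<lambda>p. Dv p $ j))"
      by (intro sum_mono poincare_H1_adm v)
    finally show ?thesis by (simp add: sum_distrib_left)
  qed
  let ?su = "\<Sum>j\<in>UNIV. gn2 a b (\<lambda>p. Du p $ j)" and ?sh = "\<Sum>j\<in>UNIV. gn2 a b (\<lambda>p. Dh p $ j)"
  have s0: "0 \<le> ?su" "0 \<le> ?sh" by (auto intro!: sum_nonneg gn2_nonneg)
  have "(LINT p:cell a b|lborel. (norm (u p))\<^sup>2) + Ha\<^sup>2 * Pm * (LINT p:cell a b|lborel. (norm (h p))\<^sup>2)
      \<le> 25 * ?su + Ha\<^sup>2 * Pm * (25 * ?sh)"
    by (intro add_mono mult_left_mono poincare[OF u] poincare[OF h]) (use Pm in auto)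
  also have "\<dots> = 25 * (1 * ?su + Pm * (Ha\<^sup>2 * ?sh))"
    by (simp add: algebra_simps)
  also have "\<dots> \<le> 25 * (max 1 Pm * ?su + max 1 Pm * (Ha\<^sup>2 * ?sh))"
    using s0 by (intro mult_left_mono add_mono mult_right_mono) auto
  finally show ?thesis by (simp add: algebra_simps)
qed

lemma perturbation_energy_derivative:
  assumes pert: "perturbation a b Ha Pm Rey U Bb u h P" and Rey: "0 < Rey" and t: "0 \<le> t"
  shows "(energy a b (Ha\<^sup>2 * Pm) u h has_real_derivative
      Iform a b (Ha\<^sup>2 * Pm) U Bb (\<lambda>p. u (p, t)) (\<lambda>p. h (p, t))
      - 1 / Rey * ((\<Sum>j\<in>UNIV. gn2 a b (\<lambda>p. jacobian u t p $ j))
          + Ha\<^sup>2 * (\<Sum>j\<in>UNIV. gn2 a b (\<lambda>p. jacobian h t p $ j)))) (at t within {0..})"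
proof -
  let ?A = "Ha\<^sup>2 * Pm" and ?r = "1 / (Pm * Rey)" and ?e = "1 / Rey"
  have u: "boundary_field a b u" and h: "boundary_field a b h"
    using pert by (auto simp: perturbation_def boundary_field_def Let_def)
  then have C1: "C1_Dom u" "C1_Dom h" by (auto simp: boundary_field_def C2_Dom_def)
  have P: "C1_Dom P" using pert by (simp add: perturbation_def C2_Dom_def Let_def)
  have perP: "cell_periodic a b (\<lambda>p. P (p, t))"
    using pert t by (simp add: perturbation_def Let_def cell_periodic_def Dom_iff_slab)
  note eqs = pert[unfolded perturbation_def Let_def, THEN conjunct2, THEN conjunct2, THEN conjunct2,
      THEN conjunct2, THEN conjunct2]
  have pde: "pd tdir u (p, t) + U (p$3) *\<^sub>R pd (sdir 1) u (p, t) + (u (p, t) $ 3 * deriv U (p$3)) *\<^sub>R axis 1 1 + adv u u (p, t)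
          = ?A *\<^sub>R (Bb (p$3) *\<^sub>R pd (sdir 1) h (p, t) + ?r *\<^sub>R pd (sdir 3) h (p, t)
                     + (h (p, t) $ 3 * deriv Bb (p$3)) *\<^sub>R axis 1 1 + adv h h (p, t))
            - sgrad P (p, t) + ?e *\<^sub>R lap u (p, t)"
    "pd tdir h (p, t) + (u (p, t) $ 3 * deriv Bb (p$3)) *\<^sub>R axis 1 1 + U (p$3) *\<^sub>R pd (sdir 1) h (p, t) + adv u h (p, t)
          - Bb (p$3) *\<^sub>R pd (sdir 1) u (p, t) - ?r *\<^sub>R pd (sdir 3) u (p, t)
          - (h (p, t) $ 3 * deriv U (p$3)) *\<^sub>R axis 1 1 - adv h u (p, t)
          = ?r *\<^sub>R lap h (p, t)"
    "dvg u (p, t) = 0" "dvg h (p, t) = 0" if "p \<in> slab" for p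
    using bspec[OF eqs, of "(p, t)"] t that unfolding Dom_iff_slab fst_conv by blast+
  have "(LINT p:cell a b|lborel. \<Sum>j\<in>UNIV. u (p, t) $ j * pd tdir u (p, t) $ j + ?A * (h (p, t) $ j * pd tdir h (p, t) $ j))
      = Iform a b ?A U Bb (\<lambda>p. u (p, t)) (\<lambda>p. h (p, t)) - ?e * (\<Sum>j\<in>UNIV. gn2 a b (\<lambda>p. jacobian u t p $ j))
        - ?A * ?r * (\<Sum>j\<in>UNIV. gn2 a b (\<lambda>p. jacobian h t p $ j))"
  proof (rule energy_identity[OF a b, where P="\<lambda>p. P (p, t)" and DP="\<lambda>p. sgrad P (p, t)"
      and D2u="\<lambda>i j p. pd (sdir i) (pd (sdir i) u) (p, t) $ j"
      and D2h="\<lambda>i j p. pd (sdir i) (pd (sdir i) h) (p, t) $ j"])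
    show "slice_deriv i (\<lambda>p. P (p, t)) (\<lambda>p. sgrad P (p, t) $ i)" for i
      using slice_deriv_pd_scalar[OF P t] by (simp add: sgrad_def)
    fix p assume p: "p \<in> slab"
    show "(\<Sum>i\<in>UNIV. jacobian u t p $ i $ i) = 0" "(\<Sum>i\<in>UNIV. jacobian h t p $ i $ i) = 0"
      using pde(3,4)[OF p] C1 by (simp_all add: dvg_def jacobian_def pd_component t p)
    fix j
    have ax: "axis 1 1 $ j = (if j = 1 then 1 else 0 :: real)" for j :: 3 by (simp add: axis_def)
    show "pd tdir u (p, t) $ j + U (p$3) * jacobian u t p $ j $ 1 + (if j = 1 then u (p, t) $ 3 * deriv U (p$3) else 0)
          + (\<Sum>i\<in>UNIV. u (p, t) $ i * jacobian u t p $ j $ i)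
        = ?A * (Bb (p$3) * jacobian h t p $ j $ 1 + ?r * jacobian h t p $ j $ 3
            + (if j = 1 then h (p, t) $ 3 * deriv Bb (p$3) else 0)
            + (\<Sum>i\<in>UNIV. h (p, t) $ i * jacobian h t p $ j $ i)) - sgrad P (p, t) $ j
          + ?e * (\<Sum>i\<in>UNIV. pd (sdir i) (pd (sdir i) u) (p, t) $ j)"
      using arg_cong[OF pde(1)[OF p], of "\<lambda>v. v $ j"]
      by (simp add: jacobian_def adv_def lap_def ax sum_component if_distrib cong: if_cong)
    show "pd tdir h (p, t) $ j + (if j = 1 then u (p, t) $ 3 * deriv Bb (p$3) else 0) + U (p$3) * jacobian h t p $ j $ 1
          + (\<Sum>i\<in>UNIV. u (p, t) $ i * jacobian h t p $ j $ i) - Bb (p$3) * jacobian u t p $ j $ 1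
          - ?r * jacobian u t p $ j $ 3 - (if j = 1 then h (p, t) $ 3 * deriv U (p$3) else 0)
          - (\<Sum>i\<in>UNIV. h (p, t) $ i * jacobian u t p $ j $ i)
        = ?r * (\<Sum>i\<in>UNIV. pd (sdir i) (pd (sdir i) h) (p, t) $ j)"
      using arg_cong[OF pde(2)[OF p], of "\<lambda>v. v $ j"]
      by (simp add: jacobian_def adv_def lap_def ax sum_component if_distrib cong: if_cong)
  qed (intro boundary_field_slices[OF u t] boundary_field_slices[OF h t] perP U Bb)+
  \<comment> \<open>A / Rm = \<open>Ha\<^sup>2\<close> / Re: the choice of A cancels the magnetic
    Prandtl number from the dissipation.\<close>
  moreover have "?A * ?r * S = ?e * (Ha\<^sup>2 * S)" for S using Pm by simp
  ultimately show ?thesis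
    using energy_has_derivative[OF a b C1 t, of ?A] by (simp only: distrib_left diff_diff_eq)
qed

lemma perturbation_energy_decay:
  assumes pert: "perturbation a b Ha Pm Rey U Bb u h P" and Rey: "0 < Rey"
    and sub: "Rey < ReE a b Ha Pm U Bb" and t: "0 \<le> t"
  defines "R \<equiv> ReE a b Ha Pm U Bb"
  shows "energy a b (Ha\<^sup>2 * Pm) u h t
    \<le> energy a b (Ha\<^sup>2 * Pm) u h 0 * exp (2 / (25 * max 1 Pm * R\<^sup>2) * (Rey - R) * t)"
proof (rule gronwall_decay[OF perturbation_energy_derivative[OF pert Rey] _ t])
  fix t :: real assume t: "0 \<le> t"
  let ?A = "Ha\<^sup>2 * Pm"
  let ?su = "\<Sum>j\<in>UNIV. gn2 a b (\<lambda>p. jacobian u t p $ j)" and ?sh = "\<Sum>j\<in>UNIV. gn2 a b (\<lambda>p. jacobian h t p $ j)"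
  let ?u = "zero_ext (\<lambda>p. u (p, t))" and ?h = "zero_ext (\<lambda>p. h (p, t))"
  let ?Du = "zero_ext (jacobian u t)" and ?Dh = "zero_ext (jacobian h t)"
  define D where "D = ?su + Ha\<^sup>2 * ?sh"
  define k where "k = 25 * max 1 Pm"
  have R: "0 < R" "Rey < R" using Rey sub by (auto simp: R_def)
  have k: "0 < k" by (simp add: k_def)
  have u: "boundary_field a b u" and h: "boundary_field a b h"
    using pert by (auto simp: perturbation_def boundary_field_def Let_def)
  note adm = boundary_field_H1_adm[OF u t] boundary_field_H1_adm[OF h t]
  note zext = gn2_zero_ext[OF a b] Iform_zero_ext[OF a b]
  have div: "(\<Sum>i\<in>UNIV. ?Du p $ i $ i) = 0" "(\<Sum>i\<in>UNIV. ?Dh p $ i $ i) = 0" for p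
  proof -
    have "dvg u (p, t) = 0" "dvg h (p, t) = 0" if "p \<in> slab"
      using pert t that by (auto simp: perturbation_def Let_def Dom_iff_slab)
    then show "(\<Sum>i\<in>UNIV. ?Du p $ i $ i) = 0" "(\<Sum>i\<in>UNIV. ?Dh p $ i $ i) = 0"
      using u h t by (auto simp: zero_ext_def dvg_def jacobian_def pd_component boundary_field_def C2_Dom_def)
  qed
  have g0: "0 \<le> gn2 a b g" for g by (rule gn2_nonneg)
  \<comment> \<open>The variational bound is applied to the extended fields; integrals over the cell
    do not see the extension.\<close>
  have "Iform a b ?A U Bb (\<lambda>p. u (p, t)) (\<lambda>p. h (p, t)) \<le> 1 / R * D1form a b Ha ?Du ?Dh"
    using Iform_le_ReE[OF adm div] by (simp add: zext R_def)
  also have "\<dots> \<le> 1 / R * D"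
  proof (rule mult_left_mono)
    show "D1form a b Ha ?Du ?Dh \<le> D"
      using g0[of "\<lambda>p. jacobian u t p $ 2"]
        mult_nonneg_nonneg[OF zero_le_power2[of Ha] g0[of "\<lambda>p. jacobian h t p $ 2"]]
      by (simp add: D1form_def zext D_def sum_3 distrib_left)
  qed (use R(1) in simp)
  finally have I: "Iform a b ?A U Bb (\<lambda>p. u (p, t)) (\<lambda>p. h (p, t)) \<le> 1 / R * D" .
  have "(LINT p:cell a b|lborel. (norm (?u p))\<^sup>2) + ?A * (LINT p:cell a b|lborel. (norm (?h p))\<^sup>2) \<le> k * D"
    using dissipation_bound[OF adm] by (simp add: zext D_def k_def)
  moreover have "(LINT p:cell a b|lborel. (norm (zero_ext v p))\<^sup>2) = (LINT p:cell a b|lborel. (norm (v p))\<^sup>2)"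
    for v :: "real^3 \<Rightarrow> real^3"
    by (rule LINT_cell_zero_ext[OF a b]) (simp add: zero_ext_def)
  ultimately have E: "2 * energy a b ?A u h t \<le> k * D"
    by (simp add: energy_def)
  have E0: "0 \<le> energy a b ?A u h t"
    unfolding energy_def set_lebesgue_integral_def
    using Pm by (intro mult_nonneg_nonneg add_nonneg_nonneg Bochner_Integration.integral_nonneg) auto
  \<comment> \<open>Replacing Re by the larger R in the denominator removes Re from the coefficient,
    so that one constant serves all subcritical Re.\<close>
  have gap: "(R - Rey) / R\<^sup>2 \<le> 1 / Rey - 1 / R"
  proof -
    have "(R - Rey) / R\<^sup>2 \<le> (R - Rey) / (Rey * R)"
      using R Rey by (intro divide_left_mono) (auto simp: power2_eq_square)
    also have "\<dots> = 1 / Rey - 1 / R" using R Rey by (simp add: field_simps)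
    finally show ?thesis .
  qed
  \<comment> \<open>With 2 E \<le> k D, this converts the surplus dissipation into energy and gives
    the rate 2 / (k R^2).\<close>
  have "(R - Rey) / R\<^sup>2 * (2 * energy a b ?A u h t / k) \<le> (1 / Rey - 1 / R) * D"
  proof (rule mult_mono[OF gap])
    show "2 * energy a b ?A u h t / k \<le> D" using E k by (simp add: divide_le_eq mult.commute)
    show "0 \<le> 1 / Rey - 1 / R" using R Rey by (simp add: field_simps)
  qed (use E0 k in auto)
  moreover have "Iform a b ?A U Bb (\<lambda>p. u (p, t)) (\<lambda>p. h (p, t)) - 1 / Rey * D \<le> - ((1 / Rey - 1 / R) * D)"
    using I by (simp add: algebra_simps)
  moreover have "- ((R - Rey) / R\<^sup>2 * (2 * energy a b ?A u h t / k))
      = 2 / (k * R\<^sup>2) * (Rey - R) * energy a b ?A u h t"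
    using R k by (simp add: field_simps)
  ultimately show "Iform a b ?A U Bb (\<lambda>p. u (p, t)) (\<lambda>p. h (p, t)) - 1 / Rey * (?su + Ha\<^sup>2 * ?sh)
      \<le> 2 / (25 * max 1 Pm * R\<^sup>2) * (Rey - R) * energy a b ?A u h t"
    unfolding D_def[symmetric] k_def[symmetric] by linarith
qed

end

section \<open>The two basic flows and the final choice of constant\<close>

lemma continuous_deriv_if_has_derivative:
  assumes "\<And>z. (f has_real_derivative f' z) (at z)" "continuous_on UNIV f'"
  shows "continuous_on UNIV f" "continuous_on UNIV (deriv f)"
proof -
  show "continuous_on UNIV f" by (rule DERIV_continuous_on[OF assms(1)])
  have "deriv f = f'" using DERIV_imp_deriv[OF assms(1)] by auto
  then show "continuous_on UNIV (deriv f)" using assms(2) by simp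
qed

lemma continuous_profiles:
  assumes Ha: "0 < Ha"
    and UB: "(U = U_couette Ha \<and> Bb = B_couette Ha) \<or> (U = U_hartmann Ha \<and> Bb = B_hartmann Ha)"
  shows "continuous_on UNIV U" "continuous_on UNIV (deriv U)"
    "continuous_on UNIV Bb" "continuous_on UNIV (deriv Bb)"
proof -
  have s: "sinh Ha \<noteq> 0" and c: "cosh Ha - 1 \<noteq> 0"
    using Ha cosh_real_strict_mono[of 0 Ha] by auto
  have d: "(U_couette Ha has_real_derivative Ha * cosh (Ha * z) / sinh Ha) (at z)"
    "(B_couette Ha has_real_derivative - (Ha * sinh (Ha * z)) / (Ha * sinh Ha)) (at z)"
    "(U_hartmann Ha has_real_derivative - (Ha * sinh (Ha * z)) / (cosh Ha - 1)) (at z)"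
    "(B_hartmann Ha has_real_derivative (Ha * cosh (Ha * z) - sinh Ha) / (Ha * (cosh Ha - 1))) (at z)" for z
    unfolding U_couette_def[abs_def] B_couette_def[abs_def] U_hartmann_def[abs_def] B_hartmann_def[abs_def]
    by (rule DERIV_cdivide; auto intro!: derivative_eq_intros)+
  have "continuous_on UNIV (\<lambda>z. Ha * cosh (Ha * z) / sinh Ha)"
    "continuous_on UNIV (\<lambda>z. - (Ha * sinh (Ha * z)) / (Ha * sinh Ha))"
    "continuous_on UNIV (\<lambda>z. - (Ha * sinh (Ha * z)) / (cosh Ha - 1))"
    "continuous_on UNIV (\<lambda>z. (Ha * cosh (Ha * z) - sinh Ha) / (Ha * (cosh Ha - 1)))"
    using s c Ha by (auto intro!: continuous_intros)
  note cont = continuous_deriv_if_has_derivative[OF d(1) this(1)]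
    continuous_deriv_if_has_derivative[OF d(2) this(2)]
    continuous_deriv_if_has_derivative[OF d(3) this(3)]
    continuous_deriv_if_has_derivative[OF d(4) this(4)]
  show "continuous_on UNIV U" "continuous_on UNIV (deriv U)"
    "continuous_on UNIV Bb" "continuous_on UNIV (deriv Bb)"
    using UB cont by auto
qed

theorem theorem3:
  fixes Ha Pm a b :: real and U Bb :: "real \<Rightarrow> real"
  assumes "Ha > 0" and "Pm > 0" and "a > 0" and "b > 0"
    and "(U = U_couette Ha \<and> Bb = B_couette Ha) \<or> (U = U_hartmann Ha \<and> Bb = B_hartmann Ha)"
  shows "\<exists>c0 > 0. \<forall>Rey u h P. Rey > 0 \<and> Rey < ReE a b Ha Pm U Bb
           \<and> perturbation a b Ha Pm Rey U Bb u h P \<longrightarrow>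
           (\<forall>t \<ge> 0. energy a b (Ha\<^sup>2 * Pm) u h t
                    \<le> energy a b (Ha\<^sup>2 * Pm) u h 0
                       * exp (pi\<^sup>2 / 2 * c0 * (Rey - ReE a b Ha Pm U Bb) * t))"
proof (cases "0 < ReE a b Ha Pm U Bb")
  case True
  define R where "R = ReE a b Ha Pm U Bb"
  \<comment> \<open>The factor 2 / pi^2 undoes the prescribed pi^2 / 2. Only R and Pm enter, so the
    choice precedes Re and the perturbation.\<close>
  define c0 where "c0 = 2 / pi\<^sup>2 * (2 / (25 * max 1 Pm * R\<^sup>2))"
  have "0 < c0"
    using True by (simp add: c0_def R_def)
  moreover have "pi\<^sup>2 / 2 * c0 = 2 / (25 * max 1 Pm * R\<^sup>2)"
    by (simp add: c0_def)
  ultimately show ?thesis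
    using perturbation_energy_decay[OF assms(3,4,1,2) continuous_profiles[OF assms(1,5)]]
    unfolding R_def by (intro exI[of _ c0]) (simp only:, blast)
next
  \<comment> \<open>No positive Re lies below a nonpositive critical value, so any positive constant
    will do.\<close>
  case False
  then show ?thesis by (intro exI[of _ 1]) auto
qed

end
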